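(* Let $n\ge 6$. If $M$ is an indecomposable rank $3$ module in $\mathrm{CM}(B_{3,n})$ such that $M$ corresponds to a real root of $J_{3,n}$ (i.e. $\varphi(M)$ is a real root), then the profile $P_M$ is a cyclic permutation of a canonical profile; that is, some cyclic permutation of the rows of $P_M$ is canonical.
   Context: Category. Fix $n\ge 4$, $1\le k\le n/2$ (here $k=3$), $[n]=\{1,\dots,n\}$. Let $Q_C$ be the quiver with vertex set $\mathbb{Z}/n$ and arrows $x_i:i-1\to i$, $y_i:i\to i-1$. $B_{k,n}$ is the quotient of the completed path algebra $\widehat{\mathbb{C}Q_C}$ by the ideal generated by the relations $xy=yx$ and $x^k=y^{n-k}$ at each vertex. Its centre is $Z=\mathbb{C}[[t]]$, $t=\sum_i x_iy_i$. $\mathrm{CM}(B_{k,n})$ is the category of $B_{k,n}$-modules $M=(M_i)$ with all $M_i$ free $Z$-modules of the same finite rank, which is the rank of $M$. For a $k$-subset $I\subset[n]$, $L_I$ is the rank 1 module with $\mathbb{C}[[t]]$ at each vertex, $x_i$ acting as $1$ if $i\in I$ and $t$ if $i\notin I$, $y_i$ acting as $t$ if $i\in I$ and $1$ if $i\notin I$. Every rank 1 module is some $L_I$. Profile. A rank $m$ module $M$ has a filtration with rank 1 factors $L_{I_1},\dots,L_{I_m}$, listed from top to bottom so that $L_{I_m}$ is a submodule of $M$. The profile $P_M=I_1|\cdots|I_m$ of $M$ is the ordered collection of $k$-subsets occurring in the generic filtration of $M$. In terms of the lattice diagram of $M$, where $M$ is given by a configuration of subspaces of $\mathbb{C}^m$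 attached to the lattice points, the rims of $L_{I_1},\dots,L_{I_m}$ are the contours separating the regions of different multiplicity (dimension): $1$ between the top two rims, and so on, up to $m$ below the lowest rim. We write $M=L_{I_1}|\cdots|L_{I_m}$. $\mathcal{P}_{k,n}$ is the set of profiles of indecomposable modules in $\mathrm{CM}(B_{k,n})$. Canonical profiles. Write $P\in\mathcal{P}_{k,n}$ with $m$ rows as $P=(P_{ij})_{1\le i\le m,1\le j\le k}$, each row increasing. $P$ is weakly column decreasing if $P_{i,j}\ge P_{i+1,j}$ for all $j\in[k]$, $i\in[m-1]$. $P$ is canonical if it is weakly column decreasing and $P_{m,j}\ge P_{1,j-1}$ for all $2\le j\le k$. A cyclic permutation of a profile is obtained by cyclically permuting its rows. Roots. $J_{k,n}$ is the graph with nodes $1,\dots,n-1$ on a line and a node $n$ attached to node $k$; also the corresponding Kac–Moody root system with simple roots $\alpha_1,\dots,\alpha_{n-1},\beta=\alpha_n$. Its root lattice is identified with $\{x\in\mathbb{Z}^n: k\mid\sum x_i\}$ via $\alpha_i=-e_i+e_{i+1}$, $\beta=e_1+\dots+e_k$, with quadratic form $q(x)=\sum_i x_i^2+\frac{2-k}{k^2}(\sum_i x_i)^2$; among roots, real roots have $q=2$ and imaginary roots have $q<2$. For $M$ with profile $I_1|\cdots|I_m$, let $x(M)\in\mathbb{Z}^n$ have $i$-th entry the number of $j$ with $i\in I_j$, let $\varphi(M)$ be the corresponding element of the root lattice, and $q(M)=q(x(M))$. *)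

theory Defs
  imports "HOL-Analysis.Analysis" "HOL-Computational_Algebra.Computational_Algebra"
begin

section \<open>Modules over $B_{k,n}$\<close>

text \<open>
  A module over $B_{k,n}$ is written as a representation of the cyclic quiver by modules over
  $Z = \mathbb{C}[[t]]$, where $t$ is the variable \<^term>\<open>fps_X\<close>. A family indexed by the
  vertex set $\mathbb{Z}/n$ is encoded as an $n$-periodic family indexed by the integers. All spaces
  $M_i$ live in one ambient $Z$-module, given by the type \<open>'v\<close> with the scalar
  multiplication \<open>scl\<close>. The map \<open>mx i\<close> is $x_i : M_{i-1} \to M_i$ and \<open>my i\<close> is
  $y_i : M_i \to M_{i-1}$; their values outside these domains are irrelevant.
\<close>

record 'v rep =
  scl :: "complex fps \<Rightarrow> 'v \<Rightarrow> 'v"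
  sp  :: "int \<Rightarrow> 'v set"
  mx  :: "int \<Rightarrow> 'v \<Rightarrow> 'v"
  my  :: "int \<Rightarrow> 'v \<Rightarrow> 'v"

definition lin_on ::
  "('r \<Rightarrow> 'v \<Rightarrow> 'v) \<Rightarrow> ('r \<Rightarrow> 'w \<Rightarrow> 'w) \<Rightarrow> 'v::ab_group_add set
    \<Rightarrow> ('v \<Rightarrow> 'w::ab_group_add) \<Rightarrow> bool" where
  "lin_on s s' A f \<longleftrightarrow>
     (\<forall>u\<in>A. \<forall>v\<in>A. f (u + v) = f u + f v) \<and> (\<forall>c. \<forall>v\<in>A. f (s c v) = s' c (f v))"

text \<open>\<open>xpath M i j\<close> is $x_{i+j} \cdots x_{i+1} : M_i \to M_{i+j}$ and
  \<open>ypath M i j\<close> is $y_{i-j+1} \cdots y_i : M_i \to M_{i-j}$.\<close>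

fun xpath :: "'v rep \<Rightarrow> int \<Rightarrow> nat \<Rightarrow> 'v \<Rightarrow> 'v" where
  "xpath M i 0 v = v"
| "xpath M i (Suc j) v = mx M (i + int j + 1) (xpath M i j v)"

fun ypath :: "'v rep \<Rightarrow> int \<Rightarrow> nat \<Rightarrow> 'v \<Rightarrow> 'v" where
  "ypath M i 0 v = v"
| "ypath M i (Suc j) v = my M (i - int j) (ypath M i j v)"

definition free_of_rank ::
  "('r::comm_ring_1 \<Rightarrow> 'v::ab_group_add \<Rightarrow> 'v) \<Rightarrow> 'v set \<Rightarrow> nat \<Rightarrow> bool" where
  "free_of_rank s A m \<longleftrightarrow>
     (\<exists>B. finite B \<and> card B = m \<and> \<not> module.dependent s B \<and> module.span s B = A)"

text \<open>\<open>CM k n m M\<close>: $M$ is an object of $\mathrm{CM}(B_{k,n})$ of rank $m$. The element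
  $t = \sum_i x_i y_i$ acts on $M_i$ as $x_i y_i$. In the last relation
  $M_{i+k} = M_{i-(n-k)}$ by periodicity.\<close>

definition CM :: "nat \<Rightarrow> nat \<Rightarrow> nat \<Rightarrow> ('v::ab_group_add) rep \<Rightarrow> bool" where
  "CM k n m M \<longleftrightarrow>
     module (scl M) \<and>
     (\<forall>i. module.subspace (scl M) (sp M i) \<and> free_of_rank (scl M) (sp M i) m) \<and>
     (\<forall>i. sp M (i + int n) = sp M i \<and>
          (\<forall>v\<in>sp M (i - 1). mx M (i + int n) v = mx M i v) \<and>
          (\<forall>v\<in>sp M i. my M (i + int n) v = my M i v)) \<and>
     (\<forall>i. mx M i ` sp M (i - 1) \<subseteq> sp M i \<and> lin_on (scl M) (scl M) (sp M (i - 1)) (mx M i)) \<and>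
     (\<forall>i. my M i ` sp M i \<subseteq> sp M (i - 1) \<and> lin_on (scl M) (scl M) (sp M i) (my M i)) \<and>
     (\<forall>i. \<forall>v\<in>sp M i. mx M i (my M i v) = scl M fps_X v) \<and>
     (\<forall>i. \<forall>v\<in>sp M i. mx M i (my M i v) = my M (i + 1) (mx M (i + 1) v)) \<and>
     (\<forall>i. \<forall>v\<in>sp M i. xpath M i k v = ypath M i (n - k) v)"

definition submod :: "nat \<Rightarrow> ('v::ab_group_add) rep \<Rightarrow> (int \<Rightarrow> 'v set) \<Rightarrow> bool" where
  "submod n M N \<longleftrightarrow>
     (\<forall>i. module.subspace (scl M) (N i) \<and> N i \<subseteq> sp M i \<and> N (i + int n) = N i \<and>
          mx M i ` N (i - 1) \<subseteq> N i \<and> my M i ` N i \<subseteq> N (i - 1))"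

definition indecomposable :: "nat \<Rightarrow> ('v::ab_group_add) rep \<Rightarrow> bool" where
  "indecomposable n M \<longleftrightarrow>
     (\<exists>i. sp M i \<noteq> {0}) \<and>
     (\<forall>N N'. submod n M N \<and> submod n M N' \<and>
        (\<forall>i. N i \<inter> N' i = {0} \<and> sp M i = {u + v | u v. u \<in> N i \<and> v \<in> N' i}) \<longrightarrow>
        (\<forall>i. N i = {0}) \<or> (\<forall>i. N' i = {0}))"

definition rep_hom ::
  "nat \<Rightarrow> ('v::ab_group_add) rep \<Rightarrow> ('w::ab_group_add) rep \<Rightarrow> (int \<Rightarrow> 'v \<Rightarrow> 'w) \<Rightarrow> bool" where
  "rep_hom n M M' g \<longleftrightarrow>
     (\<forall>i. g i ` sp M i \<subseteq> sp M' i \<and> lin_on (scl M) (scl M') (sp M i) (g i) \<and>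
          (\<forall>v\<in>sp M i. g (i + int n) v = g i v) \<and>
          (\<forall>v\<in>sp M (i - 1). g i (mx M i v) = mx M' i (g (i - 1) v)) \<and>
          (\<forall>v\<in>sp M i. g (i - 1) (my M i v) = my M' i (g i v)))"


section \<open>Rank 1 modules and filtrations\<close>

text \<open>The representative in $\{1,\dots,n\}$ of a vertex.\<close>

definition res :: "nat \<Rightarrow> int \<Rightarrow> nat" where
  "res n i = Suc (nat ((i - 1) mod int n))"

definition L :: "nat \<Rightarrow> nat set \<Rightarrow> complex fps rep" where
  "L n I = \<lparr> scl = (*), sp = (\<lambda>_. UNIV),
     mx = (\<lambda>i v. if res n i \<in> I then v else fps_X * v),
     my = (\<lambda>i v. if res n i \<in> I then fps_X * v else v) \<rparr>"

text \<open>A filtration $M = N_0 \supseteq N_1 \supseteq \dots \supseteq N_m = 0$ with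
  $N_j / N_{j+1} \cong L_{I_{j+1}}$ for $P = [I_1,\dots,I_m]$; the factor $L_{I_m} \cong N_{m-1}$ is
  the submodule at the bottom. The isomorphism is given as an epimorphism from
  $N_j$ with kernel $N_{j+1}$.\<close>

definition filtration :: "nat \<Rightarrow> nat \<Rightarrow> ('v::ab_group_add) rep \<Rightarrow> nat set list \<Rightarrow> bool" where
  "filtration k n M P \<longleftrightarrow>
     (\<forall>I\<in>set P. I \<subseteq> {1..n} \<and> card I = k) \<and>
     (\<exists>N. N 0 = sp M \<and> (\<forall>i. N (length P) i = {0}) \<and>
        (\<forall>j\<le>length P. submod n M (N j)) \<and>
        (\<forall>j<length P. \<exists>g. rep_hom n (M\<lparr>sp := N j\<rparr>) (L n (P ! j)) g \<and>
           (\<forall>i. g i ` N j i = UNIV \<and> {v \<in> N j i. g i v = 0} = N (Suc j) i)))"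


section \<open>Lattice diagrams and profiles\<close>

text \<open>
  The points of the lattice diagram are the pairs $(a,b)$ of integers; the point $(a,b)$ lies over the
  vertex $a-b$ of the cyclic quiver. An arrow $x$ leads from $(a,b)$ to $(a+1,b)$ and an arrow $y$ from
  $(a,b)$ to $(a,b+1)$, so $t$ leads from $(a,b)$ to $(a+1,b+1)$, downwards in the picture. The
  relation $x^k = y^{n-k}$ identifies $(a+k,b)$ with $(a,b+n-k)$. A configuration attaches to
  $(a,b)$ a subspace \<open>V a b\<close> of $\mathbb{C}^m$; all arrows are inclusions.
\<close>

definition config :: "nat \<Rightarrow> nat \<Rightarrow> (int \<Rightarrow> int \<Rightarrow> (complex ^ 'm) set) \<Rightarrow> bool" where
  "config k n V \<longleftrightarrow>
     (\<forall>a b. vec.subspace (V a b) \<and> V a b \<subseteq> V (a + 1) b \<and> V a b \<subseteq> V a (b + 1) \<and>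
            V (a + int k) b = V a (b + int n - int k)) \<and>
     (\<forall>i. \<exists>r. V (i + r) r = {0}) \<and> (\<forall>i. \<exists>r. V (i + r) r = UNIV)"

text \<open>The $Z$-module $\bigoplus_r t^r V(i+r,r)$ (completed) of the configuration in column $i$.\<close>

definition column :: "(int \<Rightarrow> int \<Rightarrow> (complex ^ 'm) set) \<Rightarrow> int \<Rightarrow> (complex fls ^ 'm) set" where
  "column V i = {w. \<forall>r. (\<chi> j. fls_nth (w $ j) r) \<in> V (i + r) r}"

text \<open>
  $M$ is given by the configuration $V$ if $M_i$ is identified with column $i$, compatibly with all
  arrows. Here $i$ runs through all columns of the universal cover, and the identifications
  \<open>f i\<close> are not periodic: the relations force $f_{i+n} = t^{-(n-k)} f_i$, in accordance with
  the identification of lattice points.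
\<close>

definition lattice_diagram ::
  "nat \<Rightarrow> nat \<Rightarrow> ('v::ab_group_add) rep \<Rightarrow> (int \<Rightarrow> int \<Rightarrow> (complex ^ 'm) set) \<Rightarrow> bool" where
  "lattice_diagram k n M V \<longleftrightarrow>
     config k n V \<and>
     (\<exists>f. \<forall>i. bij_betw (f i) (sp M i) (column V i) \<and>
          lin_on (scl M) (\<lambda>c w. fps_to_fls c *s w) (sp M i) (f i) \<and>
          (\<forall>v\<in>sp M (i - 1). f i (mx M i v) = f (i - 1) v) \<and>
          (\<forall>v\<in>sp M i. f (i - 1) (my M i v) = fls_X *s f i v))"

text \<open>
  The contour with number $j$ bounds the region of multiplicity at least $j$ from above; in column $i$
  its point is \<open>(i + r, r)\<close> with \<open>r = contour V j i\<close>. It is the rim of $L_I$, where $i \in I$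
  if and only if the contour follows the arrow $x_i$ from column $i-1$ to column $i$, i.e. $x_i$ maps
  generator to generator, as in \<^const>\<open>L\<close>.
\<close>

definition contour :: "(int \<Rightarrow> int \<Rightarrow> (complex ^ 'm) set) \<Rightarrow> nat \<Rightarrow> int \<Rightarrow> int" where
  "contour V j i = (LEAST r. j \<le> vec.dim (V (i + r) r))"

definition rim_set :: "nat \<Rightarrow> (int \<Rightarrow> int \<Rightarrow> (complex ^ 'm) set) \<Rightarrow> nat \<Rightarrow> nat set" where
  "rim_set n V j = {i \<in> {1..n}. contour V j (int i) = contour V j (int i - 1)}"

text \<open>$P = P_M$, where $M$ is given by the lattice diagram $V$: the rank 1 modules $L_{I_1},\dots,L_{I_m}$
  of a filtration of $M$ which have, from top to bottom, the contours of $V$ as their rims.\<close>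

definition is_profile ::
  "nat \<Rightarrow> nat \<Rightarrow> ('v::ab_group_add) rep \<Rightarrow> (int \<Rightarrow> int \<Rightarrow> (complex ^ 'm) set) \<Rightarrow> nat set list \<Rightarrow> bool" where
  "is_profile k n M V P \<longleftrightarrow>
     filtration k n M P \<and> lattice_diagram k n M V \<and>
     length P = CARD('m) \<and> (\<forall>j<length P. P ! j = rim_set n V (Suc j))"


section \<open>Canonical profiles\<close>

text \<open>Rows and columns are counted from 0.\<close>

definition entry :: "nat set list \<Rightarrow> nat \<Rightarrow> nat \<Rightarrow> nat" where
  "entry P i j = sorted_list_of_set (P ! i) ! j"

definition weakly_column_decreasing :: "nat \<Rightarrow> nat set list \<Rightarrow> bool" where
  "weakly_column_decreasing k P \<longleftrightarrow>
     (\<forall>i j. Suc i < length P \<and> j < k \<longrightarrow> entry P i j \<ge> entry P (Suc i) j)"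

definition canonical :: "nat \<Rightarrow> nat set list \<Rightarrow> bool" where
  "canonical k P \<longleftrightarrow>
     weakly_column_decreasing k P \<and>
     (\<forall>j. 1 \<le> j \<and> j < k \<longrightarrow> entry P (length P - 1) j \<ge> entry P 0 (j - 1))"


section \<open>The root system of $J_{k,n}$\<close>

text \<open>Elements of the root lattice are coefficient functions on the nodes $1,\dots,n$.\<close>

definition J_adj :: "nat \<Rightarrow> nat \<Rightarrow> nat \<Rightarrow> nat \<Rightarrow> bool" where
  "J_adj k n i j \<longleftrightarrow>
     i \<in> {1..<n} \<and> j \<in> {1..<n} \<and> (j = Suc i \<or> i = Suc j) \<or> i = k \<and> j = n \<or> i = n \<and> j = k"

definition cartan :: "nat \<Rightarrow> nat \<Rightarrow> nat \<Rightarrow> nat \<Rightarrow> int" where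
  "cartan k n i j = (if i = j then 2 else if J_adj k n i j then - 1 else 0)"

definition refl :: "nat \<Rightarrow> nat \<Rightarrow> nat \<Rightarrow> (nat \<Rightarrow> int) \<Rightarrow> nat \<Rightarrow> int" where
  "refl k n i c = c(i := c i - (\<Sum>j=1..n. cartan k n i j * c j))"

text \<open>Real roots are the images of simple roots under the Weyl group.\<close>

inductive_set real_roots :: "nat \<Rightarrow> nat \<Rightarrow> (nat \<Rightarrow> int) set" for k n :: nat where
  simple: "i \<in> {1..n} \<Longrightarrow> (\<lambda>j. if j = i then 1 else 0) \<in> real_roots k n"
| reflect: "c \<in> real_roots k n \<Longrightarrow> i \<in> {1..n} \<Longrightarrow> refl k n i c \<in> real_roots k n"

text \<open>The identification of the root lattice with a sublattice of $\mathbb{Z}^n$: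
  $\alpha_i = -e_i + e_{i+1}$ for $i < n$ and $\alpha_n = \beta = e_1 + \dots + e_k$.\<close>

definition simple_vec :: "nat \<Rightarrow> nat \<Rightarrow> nat \<Rightarrow> nat \<Rightarrow> int" where
  "simple_vec k n i =
     (if i < n then (\<lambda>j. if j = i then - 1 else if j = Suc i then 1 else 0)
      else (\<lambda>j. if j \<in> {1..k} then 1 else 0))"

definition root_vec :: "nat \<Rightarrow> nat \<Rightarrow> (nat \<Rightarrow> int) \<Rightarrow> nat \<Rightarrow> int" where
  "root_vec k n c = (\<lambda>j. \<Sum>i=1..n. c i * simple_vec k n i j)"

definition profile_vec :: "nat set list \<Rightarrow> nat \<Rightarrow> int" where
  "profile_vec P i = int (card {j. j < length P \<and> i \<in> P ! j})"

definition phi :: "nat \<Rightarrow> nat \<Rightarrow> nat set list \<Rightarrow> nat \<Rightarrow> int" where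
  "phi k n P =
     the_inv_into {c. \<forall>i. i \<notin> {1..n} \<longrightarrow> c i = 0} (root_vec k n) (profile_vec P)"

end

theory Submission
  imports Defs
begin

text \<open>
  For fixed $a$ the spaces \<open>V a b\<close> form one chain, and three consecutive values of $a$ account for
  all of them. So the diagram consists of three partial flags (line $\subseteq$ plane) in
  $\mathbb{C}^3$, possibly with missing members, together with inclusions of members of one flag into members of
  the cyclically next one. Let $e_j(m)$ be the elements of the $j$-th rim, lifted to $\mathbb{Z}$
  and numbered compatibly with the flags; then $e_3(m) \le e_2(m) \le e_1(m)$. Some rotation of the profile is
  canonical if $e_1(m) \le e_3(m+1)$ for all $m$, and each failure of this inequality puts
  the line of flag $m$ into the plane of flag $m+1$.

  For a real root $\sum_i x_i^2 = 11$ and $\sum_i x_i = 9$, so exactly one element lies in two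
  rows and none lies in three. This one coincidence either removes a line or a plane, or identifies two
  lines or two planes, or yields one more inclusion. Together with a failing inequality there
  are then so few independent subspaces that $\mathbb{C}^3$ is the direct sum of a line and a plane
  compatible with all of them, and this decomposes $M$.
\<close>

section \<open>Lines and hyperplanes adapted to a decomposition\<close>

abbreviation pairing :: "'a::field ^ 'n \<Rightarrow> 'a ^ 'n \<Rightarrow> 'a" (infixl "\<bullet>\<bullet>" 70) where
  "f \<bullet>\<bullet> x \<equiv> scalar_product f x"

lemma pairing_commute: "f \<bullet>\<bullet> x = x \<bullet>\<bullet> f"
  by (simp add: scalar_product_def mult.commute)

lemma pairing_add: "f \<bullet>\<bullet> (x + y) = f \<bullet>\<bullet> x + f \<bullet>\<bullet> y" "(x + y) \<bullet>\<bullet> f = x \<bullet>\<bullet> f + y \<bullet>\<bullet> f"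
  by (simp_all add: scalar_product_def algebra_simps sum.distrib)

lemma pairing_scale: "f \<bullet>\<bullet> (c *s x) = c * (f \<bullet>\<bullet> x)" "(c *s x) \<bullet>\<bullet> f = c * (x \<bullet>\<bullet> f)"
  by (simp_all add: scalar_product_def algebra_simps sum_distrib_left)

lemma pairing_0 [simp]: "f \<bullet>\<bullet> 0 = 0" "0 \<bullet>\<bullet> f = 0"
  by (simp_all add: scalar_product_def)

lemmas pairing_simps = pairing_add pairing_scale

lemma pairing_axis: "axis i 1 \<bullet>\<bullet> x = x $ i"
  by (simp add: scalar_product_def axis_def if_distrib[of "\<lambda>c. c * _"] cong: if_cong)

lemma subspace_kernel: "vec.subspace {x. f \<bullet>\<bullet> x = 0}"
  by (auto simp: vec.subspace_def pairing_simps)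

text \<open>A basis of \<open>S\<close> remains independent after adding \<open>a\<close>, so some
  linear map kills that basis and sends \<open>a\<close> to a unit vector. The matching row of its
  matrix is the form sought.\<close>

lemma subspace_separate:
  fixes S :: "('a::field ^ 'n) set"
  assumes "vec.subspace S" "a \<notin> S"
  obtains f where "\<And>x. x \<in> S \<Longrightarrow> f \<bullet>\<bullet> x = 0" "f \<bullet>\<bullet> a \<noteq> 0"
proof -
  obtain B where B: "B \<subseteq> S" "vec.independent B" "S \<subseteq> vec.span B"
    using vec.basis_exists by metis
  have "vec.span B = S"
    using B assms(1) by (metis subset_antisym vec.span_minimal)
  then have a: "a \<notin> vec.span B" using assms(2) by simp
  then have "a \<notin> B" using vec.span_base by blast
  with a have ind: "vec.independent (insert a B)" "a \<notin> B"
    using B(2) by (simp_all add: vec.independent_insert)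
  obtain i :: 'n where True by simp
  obtain g :: "'a ^ 'n \<Rightarrow> 'a ^ 'n" where g: "Vector_Spaces.linear (*s) (*s) g"
    "\<forall>x\<in>insert a B. g x = (if x = a then axis i 1 else 0)"
    using vec.linear_independent_extend[OF ind(1), of "\<lambda>x. if x = a then axis i 1 else 0"] by blast
  have row: "(matrix g $ i) \<bullet>\<bullet> x = g x $ i" for x
    using matrix_works[OF g(1), of x] by (simp add: scalar_product_def matrix_vector_mult_def vec_eq_iff)
  show thesis
  proof (rule that[of "matrix g $ i"])
    show "matrix g $ i \<bullet>\<bullet> a \<noteq> 0" unfolding row using g(2) by simp
  next
    fix x assume "x \<in> S"
    then have x: "x \<in> vec.span B" using B by blast
    have "vec.subspace {x. (matrix g $ i) \<bullet>\<bullet> x = 0}" by (rule subspace_kernel)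
    moreover have "B \<subseteq> {x. (matrix g $ i) \<bullet>\<bullet> x = 0}" unfolding row using g(2) ind(2) by auto
    ultimately show "matrix g $ i \<bullet>\<bullet> x = 0" using x vec.span_minimal by blast
  qed
qed

lemma in_span_singleton: "x \<in> vec.span {a} \<longleftrightarrow> (\<exists>c. x = c *s a)"
  by (auto simp: vec.span_singleton)

lemma in_span_pair: "x \<in> vec.span {a, b} \<longleftrightarrow> (\<exists>c d. x = c *s a + d *s b)"
  by (auto simp: vec.span_insert vec.span_singleton algebra_simps)

text \<open>A nonzero form misses some unit vector, so its kernel has dimension at most 2, and a
  plane inside it fills it.\<close>

lemma kernel_unique:
  fixes f :: "'a::field ^ 3"
  assumes "f \<noteq> 0" "vec.subspace S" "vec.dim S = 2" "\<And>x. x \<in> S \<Longrightarrow> f \<bullet>\<bullet> x = 0"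
  shows "S = {x. f \<bullet>\<bullet> x = 0}"
proof (rule vec.subspace_dim_equal)
  show "vec.dim S \<ge> vec.dim {x. f \<bullet>\<bullet> x = 0}"
  proof (rule ccontr)
    assume "\<not> ?thesis"
    then have "vec.dim {x. f \<bullet>\<bullet> x = 0} = vec.dim (UNIV :: ('a^3) set)"
      using assms(3) vec.dim_subset_UNIV[of "{x. f \<bullet>\<bullet> x = 0}"] vec_dim_card[where 'n=3, where 'a='a]
      by (simp add: vec.dimension_def card_cart_basis)
    then have "{x. f \<bullet>\<bullet> x = 0} = UNIV"
      by (metis order_refl subspace_kernel subset_UNIV vec.subspace_UNIV vec.subspace_dim_equal)
    then have "f \<bullet>\<bullet> axis i 1 = 0" for i by blast
    then have "f = 0" by (simp add: vec_eq_iff pairing_commute[of f] pairing_axis)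
    then show False using assms(1) by simp
  qed
qed (use assms subspace_kernel in auto)

lemma kernel_exists:
  fixes S :: "('a::field ^ 3) set"
  assumes "vec.subspace S" "vec.dim S = 2"
  obtains f where "f \<noteq> 0" "S = {x. f \<bullet>\<bullet> x = 0}"
proof -
  have "S \<noteq> UNIV" using assms(2) vec_dim_card[where 'n=3, where 'a='a] by auto
  then obtain a where "a \<notin> S" by blast
  then obtain f where "\<And>x. x \<in> S \<Longrightarrow> f \<bullet>\<bullet> x = 0" "f \<bullet>\<bullet> a \<noteq> 0"
    using subspace_separate[OF assms(1)] by metis
  then show thesis using that kernel_unique[OF _ assms] by (metis pairing_0(2))
qed

lemma line_exists:
  fixes S :: "('a::field ^ 'n) set"
  assumes "vec.subspace S" "vec.dim S = 1"
  obtains a where "a \<noteq> 0" "S = vec.span {a}"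
proof -
  obtain B where B: "B \<subseteq> S" "vec.independent B" "S \<subseteq> vec.span B" "card B = 1"
    using vec.basis_exists assms(2) by metis
  then obtain a where a: "B = {a}" by (meson card_1_singletonE)
  then have "a \<noteq> 0" using B(2) by auto
  moreover have "S = vec.span {a}" using B a assms(1) by (metis subset_antisym vec.span_minimal)
  ultimately show thesis using that by blast
qed

text \<open>Supplies the second summand once only one vector or form remains to be adapted. If
  \<open>u\<close> is a multiple of \<open>a\<close>, the nonzero factor can be inverted; otherwise
  a form separates \<open>u\<close> from the line of \<open>a\<close>.\<close>

lemma separate_pair:
  fixes a u :: "'a::field ^ 'n"
  assumes "u \<noteq> 0"
  obtains f where "f \<bullet>\<bullet> u \<noteq> 0" "a \<in> vec.span {u} \<or> f \<bullet>\<bullet> a = 0"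
proof (cases "u \<in> vec.span {a}")
  case True
  then obtain c where "u = c *s a" by (auto simp: in_span_singleton)
  with assms have "a = inverse c *s u" by auto
  then have "a \<in> vec.span {u}" by (auto simp: in_span_singleton)
  moreover obtain f where "f \<bullet>\<bullet> u \<noteq> 0"
    using subspace_separate[of "{0}" u] assms by auto
  ultimately show thesis using that by blast
next
  case False
  obtain f where "\<And>x. x \<in> vec.span {a} \<Longrightarrow> f \<bullet>\<bullet> x = 0" "f \<bullet>\<bullet> u \<noteq> 0"
    using subspace_separate[OF vec.subspace_span False] by metis
  then show thesis using that vec.span_base[of a "{a}"] by blast
qed

text \<open>The line spanned by \<open>u\<close> and the kernel of \<open>f\<close> are the summands of a decomposition to which all
  lines \<open>a \<in> A\<close> and all hyperplanes \<open>ker g\<close>, \<open>g \<in> G\<close>, are adapted.\<close>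

definition splits :: "('a::field ^ 'n) set \<Rightarrow> ('a ^ 'n) set \<Rightarrow> bool" where
  "splits A G \<longleftrightarrow> (\<exists>u f. f \<bullet>\<bullet> u \<noteq> 0 \<and> (\<forall>a\<in>A. a \<in> vec.span {u} \<or> f \<bullet>\<bullet> a = 0) \<and>
     (\<forall>g\<in>G. g \<in> vec.span {f} \<or> g \<bullet>\<bullet> u = 0))"

lemma splitsI:
  assumes "f \<bullet>\<bullet> u \<noteq> 0" "\<And>a. a \<in> A \<Longrightarrow> a \<in> vec.span {u} \<or> f \<bullet>\<bullet> a = 0"
    "\<And>g. g \<in> G \<Longrightarrow> g \<in> vec.span {f} \<or> g \<bullet>\<bullet> u = 0"
  shows "splits A G"
  using assms unfolding splits_def by blast

text \<open>Duality: the symmetric pairing lets vectors and forms trade places, so each splitting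
  pattern for lines also serves for planes.\<close>

lemma splits_commute:
  assumes "splits A G"
  shows "splits G A"
proof -
  obtain u f where uf: "f \<bullet>\<bullet> u \<noteq> 0" "\<forall>a\<in>A. a \<in> vec.span {u} \<or> f \<bullet>\<bullet> a = 0"
     "\<forall>g\<in>G. g \<in> vec.span {f} \<or> g \<bullet>\<bullet> u = 0"
    using assms unfolding splits_def by blast
  show ?thesis
  proof (rule splitsI[of u f])
    show "u \<bullet>\<bullet> f \<noteq> 0" using uf(1) by (simp only: pairing_commute[of u f] not_False_eq_True)
  next
    fix g assume "g \<in> G"
    then show "g \<in> vec.span {f} \<or> u \<bullet>\<bullet> g = 0"
      unfolding pairing_commute[of u g] using uf(3) by blast
  next
    fix a assume "a \<in> A"
    then show "a \<in> vec.span {u} \<or> a \<bullet>\<bullet> f = 0"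
      unfolding pairing_commute[of a f] using uf(2) by blast
  qed
qed

text \<open>Being adapted is inherited by scalar multiples of a generator. Coinciding lines or
  planes may therefore share one representative, and missing ones may be left out.\<close>

lemma splits_mono:
  assumes "splits A G" "\<And>a. a \<in> A' \<Longrightarrow> \<exists>b\<in>A. a \<in> vec.span {b}"
    "\<And>g. g \<in> G' \<Longrightarrow> \<exists>h\<in>G. g \<in> vec.span {h}"
  shows "splits A' G'"
proof -
  obtain u f where uf: "f \<bullet>\<bullet> u \<noteq> 0" "\<And>a. a \<in> A \<Longrightarrow> a \<in> vec.span {u} \<or> f \<bullet>\<bullet> a = 0"
     "\<And>g. g \<in> G \<Longrightarrow> g \<in> vec.span {f} \<or> g \<bullet>\<bullet> u = 0"
    using assms(1) unfolding splits_def by blast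
  have tr: "x \<in> vec.span {z}" if "x \<in> vec.span {y}" "y \<in> vec.span {z}" for x y z :: "'a ^ 'n"
    using that by (auto simp: in_span_singleton vector_smult_assoc)
  show ?thesis
  proof (rule splitsI[OF uf(1)])
    fix a assume "a \<in> A'"
    then obtain b where "b \<in> A" "a \<in> vec.span {b}" using assms(2) by blast
    then show "a \<in> vec.span {u} \<or> f \<bullet>\<bullet> a = 0"
      using uf(2)[of b] tr by (auto simp: in_span_singleton pairing_simps)
  next
    fix g assume "g \<in> G'"
    then obtain h where "h \<in> G" "g \<in> vec.span {h}" using assms(3) by blast
    then show "g \<in> vec.span {f} \<or> g \<bullet>\<bullet> u = 0"
      using uf(3)[of h] tr by (auto simp: in_span_singleton pairing_simps)
  qed
qed

lemma self_in_span [simp]: "a \<in> vec.span {a :: 'a::field ^ 'n}"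
  by (simp add: vec.span_base)

text \<open>Pattern of two lines, with \<open>a\<close> in one hyperplane and \<open>b\<close> in
  the two others. If \<open>b\<close> lies outside \<open>ker f\<close>, the summands are the line
  of \<open>b\<close> and \<open>ker f\<close>, which contains \<open>a\<close>.\<close>

lemma splits_flags:
  assumes "b \<noteq> 0" "f \<bullet>\<bullet> a = 0" "g \<bullet>\<bullet> b = 0" "h \<bullet>\<bullet> b = 0"
  shows "splits {a, b} {f, g, h}"
proof (cases "f \<bullet>\<bullet> b = 0")
  case False
  then show ?thesis by (rule splitsI) (use assms in auto)
next
  case True
  \<comment> \<open>Now all three hyperplanes contain \<open>b\<close>, so only \<open>a\<close>
    constrains the complement of its line.\<close>
  obtain k where "k \<bullet>\<bullet> b \<noteq> 0" "a \<in> vec.span {b} \<or> k \<bullet>\<bullet> a = 0"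
    using separate_pair assms(1) by metis
  then show ?thesis using True assms by (intro splitsI[of k b]) auto
qed

text \<open>Pattern in which \<open>ker g\<close> contains both lines while \<open>h\<close> is
  unconstrained. If \<open>g\<close> is independent of \<open>f\<close> and \<open>h\<close>, a
  vector in their kernels but outside \<open>ker g\<close> spans the complement of
  \<open>ker g\<close>. A linear relation among the three forms makes either \<open>f\<close>
  proportional to \<open>g\<close>, or all three hyperplanes contain \<open>a\<close>.\<close>

lemma splits_path:
  assumes "a \<noteq> 0" "g \<noteq> 0" "f \<bullet>\<bullet> a = 0" "g \<bullet>\<bullet> b = 0" "g \<bullet>\<bullet> a = 0"
  shows "splits {a, b} {f, g, h}"
proof (cases "g \<in> vec.span {f, h}")
  case False
  obtain u where u: "\<And>x. x \<in> vec.span {f, h} \<Longrightarrow> u \<bullet>\<bullet> x = 0" "u \<bullet>\<bullet> g \<noteq> 0"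
    using subspace_separate[OF vec.subspace_span False] by metis
  then have "f \<bullet>\<bullet> u = 0" "h \<bullet>\<bullet> u = 0" "g \<bullet>\<bullet> u \<noteq> 0"
    by (simp_all add: pairing_commute[of _ u] vec.span_base)
  then show ?thesis using assms by (intro splitsI[of g u]) auto
next
  case True
  then obtain x y where g: "g = x *s f + y *s h" by (auto simp: in_span_pair)
  show ?thesis
  proof (cases "y = 0")
    case True
    with g assms(2) have "f = inverse x *s g" by auto
    then have f: "f \<in> vec.span {g}" unfolding in_span_singleton by blast
    obtain u where u: "u \<bullet>\<bullet> g \<noteq> 0" "h \<in> vec.span {g} \<or> u \<bullet>\<bullet> h = 0"
      using separate_pair assms(2) by metis
    then show ?thesis using assms f by (intro splitsI[of g u]) (auto simp: pairing_commute[of u])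
  next
    case False
    have "y * (h \<bullet>\<bullet> a) = 0" using assms(3,5) g by (simp add: pairing_simps)
    with False have "h \<bullet>\<bullet> a = 0" by simp
    moreover obtain k where "k \<bullet>\<bullet> a \<noteq> 0" "b \<in> vec.span {a} \<or> k \<bullet>\<bullet> b = 0"
      using separate_pair assms(1) by metis
    ultimately show ?thesis using assms by (intro splitsI[of k a]) auto
  qed
qed

lemma in_span_if_kernel_subset:
  assumes "{x. f \<bullet>\<bullet> x = 0} \<subseteq> {x. g \<bullet>\<bullet> x = 0}"
  shows "g \<in> vec.span {f}"
proof (rule ccontr)
  assume "g \<notin> vec.span {f}"
  then obtain u where u: "\<And>x. x \<in> vec.span {f} \<Longrightarrow> u \<bullet>\<bullet> x = 0" "u \<bullet>\<bullet> g \<noteq> 0"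
    using subspace_separate[OF vec.subspace_span] by metis
  have "f \<bullet>\<bullet> u = 0" using u(1)[OF self_in_span] by (simp only: pairing_commute[of _ u])
  then have "g \<bullet>\<bullet> u = 0" using assms by blast
  then show False using u(2) by (simp only: pairing_commute[of _ u] not_True_eq_False)
qed

text \<open>By dimension, the independent vectors \<open>a\<close> and \<open>b\<close> already span
  \<open>ker f\<close>.\<close>

lemma annihilator_of_plane:
  fixes f g :: "'a::field ^ 3"
  assumes "f \<noteq> 0" "a \<noteq> 0" "b \<notin> vec.span {a}" "f \<bullet>\<bullet> a = 0" "f \<bullet>\<bullet> b = 0" "g \<bullet>\<bullet> a = 0" "g \<bullet>\<bullet> b = 0"
  shows "g \<in> vec.span {f}"
proof (rule in_span_if_kernel_subset)
  have d: "vec.dim (vec.span {b, a}) = 2"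
    using assms(2,3) by (simp add: vec.dim_insert)
  have "vec.span {b, a} = {x. f \<bullet>\<bullet> x = 0}"
    by (rule kernel_unique[OF assms(1) vec.subspace_span d]) (auto simp: in_span_pair pairing_simps assms)
  moreover have "vec.span {b, a} \<subseteq> {x. g \<bullet>\<bullet> x = 0}"
    by (auto simp: in_span_pair pairing_simps assms)
  ultimately show "{x. f \<bullet>\<bullet> x = 0} \<subseteq> {x. g \<bullet>\<bullet> x = 0}" by simp
qed

text \<open>Pattern of three complete flags joined by two consecutive inclusions: the incidences
  form the path \<open>f\<close>, \<open>a\<close>, \<open>g\<close>, \<open>b\<close>,
  \<open>h\<close>, \<open>c\<close>. If \<open>a\<close> is outside \<open>ker h\<close>, then its
  line and \<open>ker h\<close> are the summands.\<close>

lemma splits_chain: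
  fixes a b c :: "'a::field ^ 3"
  assumes "a \<noteq> 0" "g \<noteq> 0" "f \<bullet>\<bullet> a = 0" "g \<bullet>\<bullet> a = 0" "g \<bullet>\<bullet> b = 0" "h \<bullet>\<bullet> b = 0" "h \<bullet>\<bullet> c = 0"
  shows "splits {a, b, c} {f, g, h}"
proof (cases "h \<bullet>\<bullet> a = 0")
  case False
  then show ?thesis by (rule splitsI) (use assms in auto)
next
  case ha: True
  show ?thesis
  proof (cases "a \<in> vec.span {b, c}")
    case False
    \<comment> \<open>All three planes contain \<open>a\<close>, so any form that separates
      \<open>a\<close> from \<open>b\<close> and \<open>c\<close> gives the complement.\<close>
    then obtain k where "\<And>x. x \<in> vec.span {b, c} \<Longrightarrow> k \<bullet>\<bullet> x = 0" "k \<bullet>\<bullet> a \<noteq> 0"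
      using subspace_separate[OF vec.subspace_span] by metis
    then show ?thesis using assms ha by (intro splitsI[of k a]) (auto simp: vec.span_base)
  next
    case True
    then obtain x y where a: "a = x *s b + y *s c" by (auto simp: in_span_pair)
    show ?thesis
    proof (cases "b \<in> vec.span {a}")
      case True
      obtain k where "k \<bullet>\<bullet> a \<noteq> 0" "c \<in> vec.span {a} \<or> k \<bullet>\<bullet> c = 0"
        using separate_pair assms(1) by metis
      then show ?thesis using assms ha True by (intro splitsI[of k a]) auto
    next
      case False
      have "y \<noteq> 0"
      proof
        assume "y = 0"
        with a assms(1) have "b = inverse x *s a" by auto
        then show False using False in_span_singleton by blast
      qed
      moreover have "y * (g \<bullet>\<bullet> c) = 0" using assms(4,5) a by (simp add: pairing_simps)
      ultimately have gc: "g \<bullet>\<bullet> c = 0" by simp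
      \<comment> \<open>All three lines now lie in \<open>ker g\<close>, and \<open>ker h\<close> is
        the same plane since both contain the independent vectors \<open>a\<close> and
        \<open>b\<close>. Only \<open>f\<close> still constrains the line complementary to
        \<open>ker g\<close>.\<close>
      have h: "h \<in> vec.span {g}" using annihilator_of_plane[OF assms(2,1) False] assms ha by blast
      obtain u where u: "u \<bullet>\<bullet> g \<noteq> 0" "f \<in> vec.span {g} \<or> u \<bullet>\<bullet> f = 0"
        using separate_pair assms(2) by metis
      then show ?thesis using assms h gc by (intro splitsI[of g u]) (auto simp: pairing_commute[of u])
    qed
  qed
qed

section \<open>Decomposing a module along a lattice diagram\<close>

definition coeff_vec :: "'a::zero fls ^ 'm \<Rightarrow> int \<Rightarrow> 'a ^ 'm" where
  "coeff_vec w r = (\<chi> j. fls_nth (w $ j) r)"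

lemma coeff_vec_eqI: "(\<And>r. coeff_vec w r = coeff_vec w' r) \<Longrightarrow> w = w'"
  by (simp add: coeff_vec_def vec_eq_iff fls_eq_iff)

lemma coeff_vec_0 [simp]: "coeff_vec 0 r = 0"
  by (simp add: coeff_vec_def vec_eq_iff)

text \<open>The matrix has constant entries, so it acts on each coefficient separately and commutes
  with \<open>t\<close>; this makes it compatible with all arrows of a lattice diagram.\<close>

definition fls_mat :: "'a::field ^ 'm ^ 'm \<Rightarrow> 'a fls ^ 'm \<Rightarrow> 'a fls ^ 'm" where
  "fls_mat Q w = (\<chi> i. \<Sum>j\<in>UNIV. fls_const (Q $ i $ j) * w $ j)"

lemma coeff_vec_fls_mat: "coeff_vec (fls_mat Q w) r = Q *v coeff_vec w r"
  by (simp add: coeff_vec_def fls_mat_def matrix_vector_mult_def fls_nth_sum vec_eq_iff)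

lemma fls_mat_add: "fls_mat Q (w + w') = fls_mat Q w + fls_mat Q w'"
  by (simp add: fls_mat_def vec_eq_iff algebra_simps sum.distrib)

lemma fls_mat_diff: "fls_mat Q (w - w') = fls_mat Q w - fls_mat Q w'"
  by (simp add: fls_mat_def vec_eq_iff algebra_simps sum_subtractf)

lemma fls_mat_scale: "fls_mat Q (c *s w) = c *s fls_mat Q w"
  by (simp add: fls_mat_def vec_eq_iff sum_distrib_left mult.left_commute)

lemma fls_mat_0 [simp]: "fls_mat Q 0 = 0"
  by (simp add: fls_mat_def vec_eq_iff)

lemma fls_mat_idempotent: "Q ** Q = Q \<Longrightarrow> fls_mat Q (fls_mat Q w) = fls_mat Q w"
  by (rule coeff_vec_eqI) (simp add: coeff_vec_fls_mat matrix_vector_mul_assoc)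

lemma column_altdef: "column V i = {w. \<forall>r. coeff_vec w r \<in> V (i + r) r}"
  by (simp add: column_def coeff_vec_def)

lemma xpath_in_lattice:
  assumes "CM k n m M"
    and f: "\<And>i v. v \<in> sp M (i - 1) \<Longrightarrow> f i (mx M i v) = f (i - 1) v"
    and "v \<in> sp M i"
  shows "xpath M i j v \<in> sp M (i + int j) \<and> f (i + int j) (xpath M i j v) = f i v"
proof (induction j)
  case (Suc j)
  have "mx M (i + int j + 1) ` sp M (i + int j + 1 - 1) \<subseteq> sp M (i + int j + 1)"
    using assms(1) unfolding CM_def by blast
  then show ?case using Suc f[of "xpath M i j v" "i + int j + 1"] by (auto simp: algebra_simps)
qed (use assms(3) in simp)

lemma ypath_in_lattice:
  assumes "CM k n m M"
    and f: "\<And>i v. v \<in> sp M i \<Longrightarrow> f (i - 1) (my M i v) = fls_X *s f i v"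
    and "v \<in> sp M i"
  shows "ypath M i j v \<in> sp M (i - int j) \<and> f (i - int j) (ypath M i j v) = fls_X ^ j *s f i v"
proof (induction j)
  case (Suc j)
  have "my M (i - int j) ` sp M (i - int j) \<subseteq> sp M (i - int j - 1)"
    using assms(1) unfolding CM_def by blast
  then show ?case using Suc f[of "ypath M i j v" "i - int j"]
    by (auto simp: algebra_simps vector_smult_assoc)
qed (use assms(3) in simp)

text \<open>An idempotent that preserves every space of the diagram acts on every column.
  Transported to \<open>M\<close> by the identifications \<open>f i\<close>, its image and kernel
  are complementary submodules.\<close>

lemma indecomposable_idempotent:
  fixes V :: "int \<Rightarrow> int \<Rightarrow> (complex ^ 'm) set" and M :: "('v::ab_group_add) rep"
  assumes CM: "CM k n m M" and indec: "indecomposable n M" and lat: "lattice_diagram k n M V"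
    and "k \<le> n" and QQ: "Q ** Q = Q" and QV: "\<And>a b x. x \<in> V a b \<Longrightarrow> Q *v x \<in> V a b"
  shows "Q = 0 \<or> Q = mat 1"
proof -
  obtain f where f: "\<And>i. bij_betw (f i) (sp M i) (column V i)"
    "\<And>i. lin_on (scl M) (\<lambda>c w. fps_to_fls c *s w) (sp M i) (f i)"
    "\<And>i v. v \<in> sp M (i - 1) \<Longrightarrow> f i (mx M i v) = f (i - 1) v"
    "\<And>i v. v \<in> sp M i \<Longrightarrow> f (i - 1) (my M i v) = fls_X *s f i v"
    using lat unfolding lattice_diagram_def by blast
  have conf: "config k n V" using lat by (simp add: lattice_diagram_def)
  have mod: "module (scl M)" using CM by (simp add: CM_def)
  interpret module "scl M" by (rule mod)
  have subsp: "subspace (sp M i)" for i using CM by (simp add: CM_def)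
  have fadd: "f i (u + v) = f i u + f i v" if "u \<in> sp M i" "v \<in> sp M i" for i u v
    using f(2)[of i] that by (simp add: lin_on_def)
  have fscl: "f i (scl M c v) = fps_to_fls c *s f i v" if "v \<in> sp M i" for i c v
    using f(2)[of i] that by (simp add: lin_on_def)
  have f0: "f i 0 = 0" for i using fadd[of 0 i 0] subspace_0[OF subsp] by simp
  have inj: "u = v" if "f i u = f i v" "u \<in> sp M i" "v \<in> sp M i" for i u v
    using f(1)[of i] that by (auto simp: bij_betw_def inj_on_def)
  have per: "sp M (i + int n) = sp M i" for i using CM by (simp add: CM_def)
  \<comment> \<open>The identifications are not periodic. Going \<open>k\<close> steps along
    \<open>y\<close> and back along \<open>x\<close> multiplies \<open>w\<close> by
    \<open>t^k\<close>; replacing the way back by \<open>n - k\<close> further steps along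
    \<open>y\<close> ends at \<open>i - n\<close>. Comparing images gives the shift, written without
    negative powers of \<open>t\<close>.\<close>
  have shift: "fls_X ^ k *s f (i - int n) w = fls_X ^ n *s f i w" if w: "w \<in> sp M i" for i w
  proof -
    define v where "v = ypath M i k w"
    have v: "v \<in> sp M (i - int k)" "f (i - int k) v = fls_X ^ k *s f i w"
      using ypath_in_lattice[where f = f, OF CM f(4) w, of k] by (simp_all add: v_def)
    define u where "u = xpath M (i - int k) k v"
    have u: "u \<in> sp M i" "f i u = fls_X ^ k *s f i w"
      using xpath_in_lattice[where f = f, OF CM f(3) v(1), of k] v(2) by (simp_all add: u_def)
    have u': "u = ypath M (i - int k) (n - k) v"
      using CM v(1) unfolding CM_def u_def by blast
    have "f (i - int k - int (n - k)) u = fls_X ^ (n - k) *s f (i - int k) v"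
      using ypath_in_lattice[where f = f, OF CM f(4) v(1), of "n - k"] by (simp add: u')
    then have 1: "f (i - int n) u = fls_X ^ n *s f i w"
      using \<open>k \<le> n\<close> v(2) by (simp add: of_nat_diff vector_smult_assoc flip: power_add)
    have "u = scl M (fps_X ^ k) w"
      by (rule inj[of i]) (use u fscl[OF w] w subspace_scale[OF subsp w] in \<open>simp_all add: fps_to_fls_power\<close>)
    moreover have "w \<in> sp M (i - int n)" using per[of "i - int n"] w by simp
    ultimately show ?thesis using 1 fscl[of w "i - int n" "fps_X ^ k"] by (simp add: fps_to_fls_power)
  qed
  define N where "N i = {v \<in> sp M i. fls_mat Q (f i v) = f i v}" for i
  define N' where "N' i = {v \<in> sp M i. fls_mat Q (f i v) = 0}" for i
  have sub1: "submod n M N" "submod n M N'"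
  proof -
    have "subspace (N i)" "subspace (N' i)" for i
      unfolding N_def N'_def using subsp[of i]
      by (auto simp: subspace_def f0 fadd fscl fls_mat_add fls_mat_scale)
    moreover have "mx M i ` N (i - 1) \<subseteq> N i" "mx M i ` N' (i - 1) \<subseteq> N' i"
      "my M i ` N i \<subseteq> N (i - 1)" "my M i ` N' i \<subseteq> N' (i - 1)" for i
    proof -
      have "mx M i ` sp M (i - 1) \<subseteq> sp M i" "my M i ` sp M i \<subseteq> sp M (i - 1)"
        using CM unfolding CM_def by blast+
      then show "mx M i ` N (i - 1) \<subseteq> N i" "mx M i ` N' (i - 1) \<subseteq> N' i"
      "my M i ` N i \<subseteq> N (i - 1)" "my M i ` N' i \<subseteq> N' (i - 1)"
        unfolding N_def N'_def by (auto simp: f(3,4) fls_mat_scale)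
    qed
    moreover have "N (i + int n) = N i" "N' (i + int n) = N' i" for i
    proof -
      \<comment> \<open>By \<open>shift\<close> the two images of \<open>v\<close> differ by powers
        of \<open>t\<close>, which commute with \<open>fls_mat Q\<close> and can be
        cancelled.\<close>
      have eq: "fls_mat Q (f (i + int n) v) = f (i + int n) v \<longleftrightarrow> fls_mat Q (f i v) = f i v"
        "fls_mat Q (f (i + int n) v) = 0 \<longleftrightarrow> fls_mat Q (f i v) = 0" if "v \<in> sp M i" for v
      proof -
        have s: "fls_X ^ k *s f i v = fls_X ^ n *s f (i + int n) v"
          using shift[of v "i + int n"] that per by simp
        have c: "fls_X ^ j *s x = fls_X ^ j *s y \<longleftrightarrow> x = y" for x y :: "complex fls ^ 'm" and j
          by (simp add: vec_eq_iff)
        have "fls_mat Q (f (i + int n) v) = f (i + int n) v \<longleftrightarrow>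
            fls_mat Q (fls_X ^ n *s f (i + int n) v) = fls_X ^ n *s f (i + int n) v"
          by (simp only: fls_mat_scale c)
        also have "\<dots> \<longleftrightarrow> fls_mat Q (f i v) = f i v"
          by (simp only: s[symmetric] fls_mat_scale c)
        finally show "fls_mat Q (f (i + int n) v) = f (i + int n) v \<longleftrightarrow> fls_mat Q (f i v) = f i v" .
        have "fls_mat Q (f (i + int n) v) = 0 \<longleftrightarrow>
            fls_mat Q (fls_X ^ n *s f (i + int n) v) = fls_X ^ n *s 0"
          by (simp only: fls_mat_scale c)
        also have "\<dots> \<longleftrightarrow> fls_mat Q (fls_X ^ k *s f i v) = fls_X ^ k *s 0"
          by (simp only: s vec.scale_zero_right)
        also have "\<dots> \<longleftrightarrow> fls_mat Q (f i v) = 0"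
          by (simp only: fls_mat_scale c)
        finally show "fls_mat Q (f (i + int n) v) = 0 \<longleftrightarrow> fls_mat Q (f i v) = 0" .
      qed
      then show "N (i + int n) = N i" "N' (i + int n) = N' i"
        unfolding N_def N'_def per by blast+
    qed
    ultimately show "submod n M N" "submod n M N'"
      unfolding submod_def by (auto simp: N_def N'_def)
  qed
  have sum: "N i \<inter> N' i = {0} \<and> sp M i = {u + v | u v. u \<in> N i \<and> v \<in> N' i}" for i
  proof (intro conjI equalityI subsetI)
    fix v assume "v \<in> N i \<inter> N' i"
    then have "v \<in> sp M i" "f i v = f i 0" by (auto simp: N_def N'_def f0)
    then show "v \<in> {0}" using inj[of i v 0] subspace_0[OF subsp] by simp
  next
    fix v :: 'v assume "v \<in> {0}"
    then show "v \<in> N i \<inter> N' i" using subspace_0[OF subsp] by (auto simp: N_def N'_def f0)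
  next
    fix v assume v: "v \<in> sp M i"
    then have "f i v \<in> column V i" using f(1)[of i] by (auto simp: bij_betw_def)
    then have "fls_mat Q (f i v) \<in> column V i"
      by (auto simp: column_altdef coeff_vec_fls_mat QV)
    then obtain u where u: "u \<in> sp M i" "f i u = fls_mat Q (f i v)"
      using f(1)[of i] by (metis bij_betw_def imageE)
    then have vu: "v - u \<in> sp M i" using v subspace_diff[OF subsp] by blast
    have "f i (v - u) = f i v - f i u" using fadd[OF vu u(1)] by simp
    then have "u \<in> N i" "v - u \<in> N' i"
      using u v vu by (auto simp: N_def N'_def fls_mat_idempotent[OF QQ] fls_mat_diff)
    moreover have "v = u + (v - u)" by simp
    ultimately show "v \<in> {u + v | u v. u \<in> N i \<and> v \<in> N' i}" by blast
  next
    fix v assume "v \<in> {u + v | u v. u \<in> N i \<and> v \<in> N' i}"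
    then show "v \<in> sp M i" using subspace_add[OF subsp[of i]] by (auto simp: N_def N'_def)
  qed
  \<comment> \<open>Column 0 reaches the whole space at some \<open>r\<close>, so it contains
    \<open>y t^r\<close>. This realises every nonzero constant vector inside \<open>M\<close> and
    lets the vanishing of a summand be read off \<open>Q\<close>.\<close>
  have nz: "\<exists>v\<in>sp M 0. v \<noteq> 0 \<and> (\<forall>r. coeff_vec (f 0 v) r \<in> {0, y})" if y: "y \<noteq> 0" for y
  proof -
    obtain r where r: "V (0 + r) r = UNIV" using conf unfolding config_def by blast
    define w where "w = (\<chi> j. fls_const (y $ j) * fls_X_intpow r)"
    have cw: "coeff_vec w s = (if s = r then y else 0)" for s
      by (auto simp: coeff_vec_def w_def vec_eq_iff fls_X_intpow_times_conv_shift(2))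
    have "0 \<in> V a b" for a b using conf vec.subspace_0 unfolding config_def by blast
    then have "w \<in> column V 0" using r by (auto simp: column_altdef cw)
    then obtain v where v: "v \<in> sp M 0" "f 0 v = w"
      using f(1)[of 0] by (metis bij_betw_def imageE)
    have "w \<noteq> 0"
    proof
      assume "w = 0"
      then have "coeff_vec w r = 0" by (simp add: coeff_vec_def vec_eq_iff)
      then show False using cw y by simp
    qed
    then have "v \<noteq> 0" using v f0 by auto
    then show ?thesis using v cw by (intro bexI[of _ v]) auto
  qed
  have "(\<forall>i. N i = {0}) \<or> (\<forall>i. N' i = {0})"
    using indec sub1 sum unfolding indecomposable_def by blast
  then show ?thesis
  proof
    assume N: "\<forall>i. N i = {0}"
    have "Q *v x = 0" for x
    proof (rule ccontr)
      assume "Q *v x \<noteq> 0"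
      then obtain v where v: "v \<in> sp M 0" "v \<noteq> 0" "\<And>r. coeff_vec (f 0 v) r \<in> {0, Q *v x}" using nz by blast
      have "fls_mat Q (f 0 v) = f 0 v"
      proof (rule coeff_vec_eqI)
        fix r show "coeff_vec (fls_mat Q (f 0 v)) r = coeff_vec (f 0 v) r"
          using v(3)[of r] by (auto simp: coeff_vec_fls_mat matrix_vector_mul_assoc QQ)
      qed
      then show False using v N by (auto simp: N_def)
    qed
    then show ?thesis by (metis matrix_eq matrix_vector_mult_0)
  next
    assume N: "\<forall>i. N' i = {0}"
    have "x - Q *v x = 0" for x
    proof (rule ccontr)
      assume "x - Q *v x \<noteq> 0"
      then obtain v where v: "v \<in> sp M 0" "v \<noteq> 0" "\<And>r. coeff_vec (f 0 v) r \<in> {0, x - Q *v x}" using nz by blast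
      have "fls_mat Q (f 0 v) = 0"
      proof (rule coeff_vec_eqI)
        fix r show "coeff_vec (fls_mat Q (f 0 v)) r = coeff_vec 0 r"
          using v(3)[of r]
          by (auto simp: coeff_vec_fls_mat matrix_vector_mult_diff_distrib matrix_vector_mul_assoc QQ)
      qed
      then show False using v N by (auto simp: N'_def)
    qed
    then show ?thesis by (metis matrix_eq matrix_vector_mul_lid eq_iff_diff_eq_0)
  qed
qed

text \<open>The projection onto the line of \<open>u\<close> along \<open>ker f\<close> preserves
  every adapted line and plane. It has rank one in dimension three, so it is an idempotent other
  than 0 and 1.\<close>

lemma indecomposable_not_splits:
  fixes V :: "int \<Rightarrow> int \<Rightarrow> (complex ^ 3) set" and M :: "('v::ab_group_add) rep"
  assumes "CM k n m M" "indecomposable n M" "lattice_diagram k n M V" "k \<le> n"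
    and V: "\<And>a b. V a b = {0} \<or> V a b = UNIV \<or> (\<exists>x\<in>A. V a b = vec.span {x}) \<or> (\<exists>g\<in>G. V a b = {x. g \<bullet>\<bullet> x = 0})"
  shows "\<not> splits A G"
proof
  assume "splits A G"
  then obtain u f where uf: "f \<bullet>\<bullet> u \<noteq> 0" "\<And>a. a \<in> A \<Longrightarrow> a \<in> vec.span {u} \<or> f \<bullet>\<bullet> a = 0"
     "\<And>g. g \<in> G \<Longrightarrow> g \<in> vec.span {f} \<or> g \<bullet>\<bullet> u = 0"
    unfolding splits_def by blast
  define Q :: "complex ^ 3 ^ 3" where "Q = (\<chi> i j. u $ i * f $ j / (f \<bullet>\<bullet> u))"
  have Q: "Q *v x = (f \<bullet>\<bullet> x / (f \<bullet>\<bullet> u)) *s u" for x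
    by (simp add: Q_def matrix_vector_mult_def vec_eq_iff scalar_product_def sum_divide_distrib
        sum_distrib_left sum_distrib_right mult_ac)
  have "u \<noteq> 0" using uf(1) by auto
  have QQ: "Q ** Q = Q"
    using uf(1) by (simp add: matrix_eq Q pairing_simps flip: matrix_vector_mul_assoc)
  have "Q *v x \<in> V a b" if x: "x \<in> V a b" for a b x
  proof -
    consider "V a b = {0}" | "V a b = UNIV" | y where "y \<in> A" "V a b = vec.span {y}"
      | g where "g \<in> G" "V a b = {x. g \<bullet>\<bullet> x = 0}" using V[of a b] by blast
    then show ?thesis
    proof cases
      case 3
      then obtain c where c: "x = c *s y" using x by (auto simp: in_span_singleton)
      show ?thesis using uf(2)[OF 3(1)]
      proof
        assume "y \<in> vec.span {u}"
        then obtain d where "y = d *s u" by (auto simp: in_span_singleton)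
        then have "Q *v x = x" using c uf(1) by (simp add: Q pairing_simps vector_smult_assoc)
        then show ?thesis using x by simp
      next
        assume "f \<bullet>\<bullet> y = 0"
        then show ?thesis using 3(2) c by (simp add: Q pairing_simps vec.span_zero)
      qed
    next
      case 4
      show ?thesis using uf(3)[OF 4(1)]
      proof
        assume "g \<in> vec.span {f}"
        then obtain d where "g = d *s f" by (auto simp: in_span_singleton)
        then show ?thesis using 4(2) x by (auto simp: Q pairing_simps)
      qed (use 4(2) in \<open>simp add: Q pairing_simps\<close>)
    qed (use x in \<open>auto simp: Q\<close>)
  qed
  then have "Q = 0 \<or> Q = mat 1" using indecomposable_idempotent[OF assms(1-4) QQ] by blast
  then show False
  proof
    assume "Q = 0"
    then have "Q *v u = 0" by simp
    then show False using Q[of u] uf(1) \<open>u \<noteq> 0\<close> by simp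
  next
    assume 1: "Q = mat 1"
    have "x \<in> vec.span {u}" for x
      using Q[of x] 1 by (auto simp: in_span_singleton)
    then have "vec.span {u} = UNIV" by blast
    then have "vec.dim (vec.span {u}) = 3" using vec_dim_card[where 'n=3, where 'a=complex] by simp
    then show False using \<open>u \<noteq> 0\<close> by simp
  qed
qed

section \<open>Lattice diagrams as flags\<close>

text \<open>Over the integers \<open>LEAST\<close> needs a lower bound: \<open>d\<close> supplies it
  and \<open>c\<close> gives nonemptiness. Counting upwards from \<open>d\<close> reduces the claim
  to a least natural number.\<close>

lemma int_Least_le_iff:
  fixes Q :: "int \<Rightarrow> bool"
  assumes "Q c" "\<not> Q d" and mono: "\<And>x y. x \<le> y \<Longrightarrow> Q x \<Longrightarrow> Q y"
  shows "(LEAST b. Q b) \<le> x \<longleftrightarrow> Q x"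
proof -
  have dc: "d < c" using assms by (metis linorder_not_le)
  define j where "j = (LEAST j. Q (d + int j))"
  have "Q (d + int (nat (c - d)))" using assms(1) dc by simp
  then have j: "Q (d + int j)" "\<And>i. Q (d + int i) \<Longrightarrow> j \<le> i"
    unfolding j_def by (rule LeastI, simp add: Least_le)
  have *: "d + int j \<le> y" if "Q y" for y
  proof -
    have "d < y" using that assms(2) mono by (metis linorder_not_le)
    then show ?thesis using j(2)[of "nat (y - d)"] that by simp
  qed
  have "(LEAST b. Q b) = d + int j"
    by (rule Least_equality) (use j * in auto)
  then show ?thesis using j * mono by auto
qed

text \<open>With \<open>h\<close> the first \<open>b\<close> such that \<open>V (m - 1) b\<close> has dimension at least \<open>j\<close>,
  the contour number \<open>j\<close> follows an arrow $x$ from the point \<open>(m - 1, h)\<close> to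
  the point \<open>(m, h)\<close>, which lies over the vertex \<open>position V j m\<close>.\<close>

definition position :: "(int \<Rightarrow> int \<Rightarrow> (complex ^ 'm) set) \<Rightarrow> nat \<Rightarrow> int \<Rightarrow> int" where
  "position V j m = m - (LEAST b. j \<le> vec.dim (V (m - 1) b))"

section \<open>Positions of the rims: monotonicity and periodicity\<close>

context
  fixes k n :: nat and V :: "int \<Rightarrow> int \<Rightarrow> (complex ^ 'm) set"
  assumes V: "config k n V" and k: "k > 0"
begin

lemma subspace_config: "vec.subspace (V a b)"
  using V by (simp add: config_def)

lemma config_period: "V (a + int k * s) b = V a (b + (int n - int k) * s)"
proof -
  have 1: "V (a + int k) b = V a (b + (int n - int k))" for a b
    using V by (simp add: config_def add_diff_eq)
  show ?thesis
  proof (induction s arbitrary: b rule: int_induct[where k = 0])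
    case (step1 i)
    then show ?case using 1[of "a + int k * i"] by (simp add: algebra_simps)
  next
    case (step2 i)
    have "V (a + int k * (i - 1)) b = V (a + int k * (i - 1)) (b - (int n - int k) + (int n - int k))"
      by simp
    also have "\<dots> = V (a + int k * i) (b - (int n - int k))"
      unfolding 1[symmetric] by (simp add: algebra_simps)
    also have "\<dots> = V a (b + (int n - int k) * (i - 1))"
      using step2 by (simp add: algebra_simps)
    finally show ?case .
  qed simp
qed

lemma config_mono:
  assumes "a \<le> a'" "b \<le> b'"
  shows "V a b \<subseteq> V a' b'"
proof -
  have "V a b \<subseteq> V a' b"
    using assms(1)
  proof (induction rule: int_ge_induct)
    case (step i)
    then show ?case using V unfolding config_def by blast
  qed simp
  also have "\<dots> \<subseteq> V a' b'"
    using assms(2)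
  proof (induction rule: int_ge_induct)
    case (step i)
    then show ?case using V unfolding config_def by blast
  qed simp
  finally show ?thesis .
qed

lemma dim_config_le: "vec.dim (V a b) \<le> CARD('m)"
  using dim_subset_UNIV_cart_gen by blast

lemma dim_config_mono: "a \<le> a' \<Longrightarrow> b \<le> b' \<Longrightarrow> vec.dim (V a b) \<le> vec.dim (V a' b')"
  by (intro vec.dim_subset config_mono)

lemma config_eqI:
  assumes "a \<le> a'" "b \<le> b'" "vec.dim (V a b) = vec.dim (V a' b')"
  shows "V a b = V a' b'"
  using assms by (intro vec.subspace_dim_equal config_mono subspace_config) auto

text \<open>For fixed \<open>a\<close> the dimensions grow with \<open>b\<close> from 0 to the full
  dimension, so the \<open>LEAST\<close> in \<open>position\<close> is a genuine threshold.\<close>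

lemma position_iff:
  assumes "1 \<le> j" "j \<le> CARD('m)"
  shows "j \<le> vec.dim (V a b) \<longleftrightarrow> a < b + position V j (a + 1)"
proof -
  \<comment> \<open>The definition of \<open>config\<close> gives a zero space only along columns.
    Moving it by enough periods to a first coordinate at least \<open>a\<close> forces a zero space
    over \<open>a\<close> itself; \<open>top\<close> moves a full space the other way.\<close>
  have zero: "\<exists>b. V a b = {0}"
  proof -
    obtain r where "V (0 + r) r = {0}" using V unfolding config_def by blast
    then have "V (r + int k * (\<bar>a\<bar> + \<bar>r\<bar>)) (r - (int n - int k) * (\<bar>a\<bar> + \<bar>r\<bar>)) = {0}"
      unfolding config_period by simp
    moreover have "a \<le> r + int k * (\<bar>a\<bar> + \<bar>r\<bar>)"
    proof -
      have "1 * (\<bar>a\<bar> + \<bar>r\<bar>) \<le> int k * (\<bar>a\<bar> + \<bar>r\<bar>)" using k by (intro mult_right_mono) auto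
      then show ?thesis by (simp only: distrib_left mult_1)
    qed
    ultimately have "V a (r - (int n - int k) * (\<bar>a\<bar> + \<bar>r\<bar>)) \<subseteq> {0}"
      by (metis config_mono order_refl)
    then show ?thesis using vec.subspace_0[OF subspace_config] by blast
  qed
  have top: "\<exists>b. V a b = UNIV"
  proof -
    obtain r where "V (0 + r) r = UNIV" using V unfolding config_def by blast
    then have "V (r + int k * (- \<bar>a\<bar> - \<bar>r\<bar>)) (r - (int n - int k) * (- \<bar>a\<bar> - \<bar>r\<bar>)) = UNIV"
      unfolding config_period by simp
    moreover have "r + int k * (- \<bar>a\<bar> - \<bar>r\<bar>) \<le> a"
    proof -
      have "1 * (\<bar>a\<bar> + \<bar>r\<bar>) \<le> int k * (\<bar>a\<bar> + \<bar>r\<bar>)" using k by (intro mult_right_mono) auto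
      then show ?thesis by (simp only: right_diff_distrib mult_minus_right distrib_left mult_1)
    qed
    ultimately have "UNIV \<subseteq> V a (r - (int n - int k) * (- \<bar>a\<bar> - \<bar>r\<bar>))"
      by (metis config_mono order_refl)
    then show ?thesis by blast
  qed
  obtain c d where c: "V a c = UNIV" and d: "V a d = {0}" using zero top by blast
  have "(LEAST b. j \<le> vec.dim (V a b)) \<le> b \<longleftrightarrow> j \<le> vec.dim (V a b)"
  proof (rule int_Least_le_iff[of _ c d])
    show "j \<le> vec.dim (V a c)" unfolding c using assms(2) vec_dim_card by metis
    show "\<not> j \<le> vec.dim (V a d)" unfolding d using assms(1) by simp
  qed (use dim_config_mono[of a a] order_trans in blast)
  then show ?thesis by (auto simp: position_def)
qed

text \<open>The inclusion of \<open>V (m - 1) b\<close> in \<open>V m b\<close> means that dimension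
  \<open>j\<close> is reached over \<open>m\<close> no later than over \<open>m - 1\<close>; the
  summand \<open>m\<close> in \<open>position\<close> makes the inequality strict.\<close>

lemma position_less:
  assumes "1 \<le> j" "j \<le> CARD('m)"
  shows "position V j m < position V j (m + 1)"
proof -
  have "j \<le> vec.dim (V (m - 1) (m - position V j m))"
    using position_iff[OF assms, of "m - 1" "m - position V j m"] by simp
  also have "\<dots> \<le> vec.dim (V m (m - position V j m))" by (rule dim_config_mono) auto
  finally show ?thesis using position_iff[OF assms, of m "m - position V j m"] by simp
qed

lemma position_add_le:
  assumes "1 \<le> j" "j \<le> CARD('m)"
  shows "position V j (m + int d) \<ge> position V j m + int d"
proof (induction d)
  case (Suc d)
  then show ?case using position_less[OF assms, of "m + int d"] by (simp add: algebra_simps)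
qed simp

lemma position_less_iff:
  assumes "1 \<le> j" "j \<le> CARD('m)"
  shows "position V j m < position V j m' \<longleftrightarrow> m < m'"
  using position_add_le[OF assms, of m "nat (m' - m)"]
    position_add_le[OF assms, of m' "nat (m - m')"] by (cases "m < m'") auto

lemma position_eq_iff:
  assumes "1 \<le> j" "j \<le> CARD('m)"
  shows "position V j m = position V j m' \<longleftrightarrow> m = m'"
  using position_less_iff[OF assms, of m m'] position_less_iff[OF assms, of m' m]
  by (cases m m' rule: linorder_cases) auto

lemma position_antimono:
  assumes "1 \<le> i" "i \<le> j" "j \<le> CARD('m)"
  shows "position V j m \<le> position V i m"
proof -
  have "j \<le> vec.dim (V (m - 1) (m - position V j m))"
    using position_iff[of j "m - 1" "m - position V j m"] assms by simp
  then have "i \<le> vec.dim (V (m - 1) (m - position V j m))" using assms by simp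
  then show ?thesis using position_iff[of i "m - 1" "m - position V j m"] assms by simp
qed

lemma position_period:
  assumes "1 \<le> j" "j \<le> CARD('m)"
  shows "position V j (m + int k) = position V j m + int n"
proof -
  have V: "V (m - 1 + int k) b = V (m - 1) (b + int n - int k)" for b
    using config_period[of "m - 1" 1 b] by (simp add: algebra_simps)
  have "m - 1 + int k < b + position V j (m + int k) \<longleftrightarrow> m - 1 < b + int n - int k + position V j m" for b
    using position_iff[OF assms, of "m - 1 + int k" b] position_iff[OF assms, of "m - 1" "b + int n - int k"] V[of b]
    by (simp add: add.commute)
  \<comment> \<open>Evaluating at the two thresholds gives the two opposite inequalities.\<close>
  from this[of "m + int k - position V j (m + int k)"] this[of "m + int k - (position V j m + int n)"]
  show ?thesis by simp
qed

lemma position_period_mult: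
  assumes "1 \<le> j" "j \<le> CARD('m)"
  shows "position V j (m + int k * s) = position V j m + int n * s"
proof (induction s rule: int_induct[where k = 0])
  case (step1 i)
  then show ?case using position_period[OF assms, of "m + int k * i"] by (simp add: algebra_simps)
next
  case (step2 i)
  then show ?case using position_period[OF assms, of "m + int k * (i - 1)"] by (simp add: algebra_simps)
qed simp

lemma position_threshold:
  assumes j: "1 \<le> j" "j \<le> CARD('m)"
  obtains t where "\<And>s. i < position V j s \<longleftrightarrow> t \<le> s"
proof -
  have "(LEAST t. i < position V j t) \<le> s \<longleftrightarrow> i < position V j s" for s
  proof (rule int_Least_le_iff)
    show "i < position V j (int (nat (i + 1 - position V j 0)))"
      using position_add_le[OF j, of 0 "nat (i + 1 - position V j 0)"] by (simp only: add_0)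
    show "\<not> i < position V j (- int (nat (position V j 0 - i)))"
      using position_add_le[OF j, of "- int (nat (position V j 0 - i))" "nat (position V j 0 - i)"]
      by (simp only: add.left_inverse)
    show "i < position V j y" if "x \<le> y" "i < position V j x" for x y
      using that position_less_iff[OF j, of y x] by linarith
  qed
  then show thesis using that by blast
qed

text \<open>With \<open>T i\<close> the first index whose position exceeds \<open>i\<close>, the
  contour in column \<open>i\<close> has height \<open>T i - i - 1\<close>. The height is unchanged
  from \<open>i - 1\<close> to \<open>i\<close> exactly if \<open>T\<close> grows by one there, that
  is, if \<open>i\<close> is itself a position.\<close>

lemma rim_set_position:
  assumes j: "1 \<le> j" "j \<le> CARD('m)"
  shows "rim_set n V j = {i \<in> {1..n}. int i \<in> range (position V j)}"
proof -
  have "\<exists>t. \<forall>s. t \<le> s \<longleftrightarrow> i < position V j s" for i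
    using position_threshold[OF j, of i] by metis
  then obtain T where T: "\<And>i t. T i \<le> t \<longleftrightarrow> i < position V j t" by metis
  have c: "contour V j i = T i - i - 1" for i
    unfolding contour_def position_iff[OF j]
  proof (rule Least_equality)
    show "i + (T i - i - 1) < T i - i - 1 + position V j (i + (T i - i - 1) + 1)"
      using T[of i "T i"] by simp
    show "T i - i - 1 \<le> y" if "i + y < y + position V j (i + y + 1)" for y
      using T[of i "i + y + 1"] that by simp
  qed
  have "contour V j i = contour V j (i - 1) \<longleftrightarrow> i \<in> range (position V j)" for i
  proof
    assume "contour V j i = contour V j (i - 1)"
    then have "T i = T (i - 1) + 1" by (simp add: c)
    then have "i = position V j (T (i - 1))" using T[of "i - 1" "T (i - 1)"] T[of i "T (i - 1)"] by simp
    then show "i \<in> range (position V j)" by blast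
  next
    assume "i \<in> range (position V j)"
    then obtain t where t: "i = position V j t" by blast
    have "T i \<le> s \<longleftrightarrow> t + 1 \<le> s" "T (i - 1) \<le> s \<longleftrightarrow> t \<le> s" for s
      using T[of i s] T[of "i - 1" s] position_less_iff[OF j, of t s] position_less_iff[OF j, of s t] by (auto simp: t)
    from this(1)[of "T i"] this(1)[of "t + 1"] this(2)[of "T (i - 1)"] this(2)[of t]
    show "contour V j i = contour V j (i - 1)" by (simp add: c)
  qed
  then show ?thesis by (auto simp: rim_set_def)
qed

end

section \<open>Lines and planes of the flags\<close>

text \<open>The space used is the first nonzero one over \<open>m - 1\<close>. It is a line exactly
  if positions 2 and 1 differ at \<open>m\<close>; otherwise the choice is arbitrary.\<close>

definition line_vec :: "(int \<Rightarrow> int \<Rightarrow> (complex ^ 3) set) \<Rightarrow> int \<Rightarrow> complex ^ 3" where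
  "line_vec V m = (SOME x. x \<noteq> 0 \<and> V (m - 1) (m - position V 1 m) = vec.span {x})"

text \<open>The last space over \<open>m - 1\<close> before the full one, recorded by a form with
  this kernel so that planes and lines can be treated dually. It is meaningful only if positions 3
  and 2 differ at \<open>m\<close>.\<close>

definition plane_form :: "(int \<Rightarrow> int \<Rightarrow> (complex ^ 3) set) \<Rightarrow> int \<Rightarrow> complex ^ 3" where
  "plane_form V m = (SOME f. f \<noteq> 0 \<and> V (m - 1) (m - position V 3 m - 1) = {x. f \<bullet>\<bullet> x = 0})"

context
  fixes k n :: nat and V :: "int \<Rightarrow> int \<Rightarrow> (complex ^ 3) set"
  assumes V: "config k n V" and k: "k > 0"
begin

lemma dim_config_iff:
  "1 \<le> vec.dim (V a b) \<longleftrightarrow> a < b + position V 1 (a + 1)"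
  "2 \<le> vec.dim (V a b) \<longleftrightarrow> a < b + position V 2 (a + 1)"
  "3 \<le> vec.dim (V a b) \<longleftrightarrow> a < b + position V 3 (a + 1)"
  using position_iff[OF V k, of _ a b] by simp_all

lemma line_vec:
  assumes "position V 2 m < position V 1 m"
  shows "line_vec V m \<noteq> 0" "V (m - 1) (m - position V 1 m) = vec.span {line_vec V m}"
proof -
  have "vec.dim (V (m - 1) (m - position V 1 m)) = 1"
    using dim_config_iff(1,2)[of "m - 1" "m - position V 1 m"] assms by simp
  then obtain x where "x \<noteq> 0" "V (m - 1) (m - position V 1 m) = vec.span {x}"
    by (rule line_exists[OF subspace_config[OF V k]])
  then have "\<exists>x. x \<noteq> 0 \<and> V (m - 1) (m - position V 1 m) = vec.span {x}" by blast
  from someI_ex[OF this]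
  show "line_vec V m \<noteq> 0" "V (m - 1) (m - position V 1 m) = vec.span {line_vec V m}"
    unfolding line_vec_def by blast+
qed

lemma plane_form:
  assumes "position V 3 m < position V 2 m"
  shows "plane_form V m \<noteq> 0" "V (m - 1) (m - position V 3 m - 1) = {x. plane_form V m \<bullet>\<bullet> x = 0}"
proof -
  have "vec.dim (V (m - 1) (m - position V 3 m - 1)) = 2"
    using dim_config_iff(2,3)[of "m - 1" "m - position V 3 m - 1"] assms by simp
  then obtain f where "f \<noteq> 0" "V (m - 1) (m - position V 3 m - 1) = {x. f \<bullet>\<bullet> x = 0}"
    by (rule kernel_exists[OF subspace_config[OF V k]])
  then have "\<exists>f. f \<noteq> 0 \<and> V (m - 1) (m - position V 3 m - 1) = {x. f \<bullet>\<bullet> x = 0}" by blast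
  from someI_ex[OF this]
  show "plane_form V m \<noteq> 0" "V (m - 1) (m - position V 3 m - 1) = {x. plane_form V m \<bullet>\<bullet> x = 0}"
    unfolding plane_form_def by blast+
qed

lemma config_dim_1:
  assumes "vec.dim (V a b) = 1"
  shows "position V 2 (a + 1) < position V 1 (a + 1) \<and> V a b = vec.span {line_vec V (a + 1)}"
proof
  show l: "position V 2 (a + 1) < position V 1 (a + 1)"
    using dim_config_iff(1,2)[of a b] assms by simp
  have "V a (a + 1 - position V 1 (a + 1)) = V a b"
    using dim_config_iff(1)[of a b] dim_config_iff(1,2)[of a "a + 1 - position V 1 (a + 1)"] l assms
    by (intro config_eqI[OF V k]) auto
  then show "V a b = vec.span {line_vec V (a + 1)}" using line_vec(2)[OF l] by simp
qed

lemma config_dim_2: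
  assumes "vec.dim (V a b) = 2"
  shows "position V 3 (a + 1) < position V 2 (a + 1) \<and> V a b = {x. plane_form V (a + 1) \<bullet>\<bullet> x = 0}"
proof
  show l: "position V 3 (a + 1) < position V 2 (a + 1)"
    using dim_config_iff(2,3)[of a b] assms by simp
  have "V a b = V a (a - position V 3 (a + 1))"
    using dim_config_iff(3)[of a b] dim_config_iff(2,3)[of a "a - position V 3 (a + 1)"] l assms
    by (intro config_eqI[OF V k]) auto
  then show "V a b = {x. plane_form V (a + 1) \<bullet>\<bullet> x = 0}" using plane_form(2)[OF l] by simp
qed

lemma config_cases:
  "V a b = {0} \<or> V a b = UNIV \<or>
   position V 2 (a + 1) < position V 1 (a + 1) \<and> V a b = vec.span {line_vec V (a + 1)} \<or>
   position V 3 (a + 1) < position V 2 (a + 1) \<and> V a b = {x. plane_form V (a + 1) \<bullet>\<bullet> x = 0}"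
proof -
  have "vec.dim (V a b) \<le> 3" using dim_config_le[OF V k, of a b] by simp
  then consider "vec.dim (V a b) = 0" | "vec.dim (V a b) = 1" | "vec.dim (V a b) = 2" | "vec.dim (V a b) = 3"
    by linarith
  then show ?thesis
  proof cases
    case 1
    then show ?thesis using vec.subspace_0[OF subspace_config[OF V k]] by auto
  next
    case 4
    then have "vec.dim (V a b) \<ge> vec.dim (UNIV :: (complex ^ 3) set)"
      using vec_dim_card[where 'n=3, where 'a=complex] by simp
    then have "V a b = UNIV"
      by (intro vec.subspace_dim_equal subspace_config[OF V k]) auto
    then show ?thesis by blast
  qed (use config_dim_1 config_dim_2 in blast)+
qed

lemma line_in_plane:
  assumes "position V 2 m < position V 1 m" "position V 3 m < position V 2 m"
  shows "plane_form V m \<bullet>\<bullet> line_vec V m = 0"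
proof -
  have "V (m - 1) (m - position V 1 m) \<subseteq> V (m - 1) (m - position V 3 m - 1)"
    using assms by (intro config_mono[OF V k]) auto
  then show ?thesis
    unfolding line_vec(2)[OF assms(1)] plane_form(2)[OF assms(2)] using self_in_span by blast
qed

text \<open>The position inequality puts the point carrying the line weakly before the point
  carrying the next plane, in both coordinates.\<close>

lemma line_in_next_plane:
  assumes "position V 2 m < position V 1 m" "position V 3 (m + 1) < position V 2 (m + 1)"
    "position V 3 (m + 1) \<le> position V 1 m"
  shows "plane_form V (m + 1) \<bullet>\<bullet> line_vec V m = 0"
proof -
  have "V (m - 1) (m - position V 1 m) \<subseteq> V (m + 1 - 1) (m + 1 - position V 3 (m + 1) - 1)"
    using assms by (intro config_mono[OF V k]) auto
  then show ?thesis
    unfolding line_vec(2)[OF assms(1)] plane_form(2)[OF assms(2)] using self_in_span by blast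
qed

text \<open>At the height where the line of flag \<open>m\<close> appears, the next flag has not yet
  reached dimension 2, so its space there is the same line.\<close>

lemma line_eq_next_line:
  assumes "position V 2 m < position V 1 m" "position V 2 (m + 1) \<le> position V 1 m"
  shows "vec.span {line_vec V m} = vec.span {line_vec V (m + 1)}"
proof -
  have 1: "vec.dim (V (m - 1) (m - position V 1 m)) = 1"
    using dim_config_iff(1,2)[of "m - 1" "m - position V 1 m"] assms(1) by simp
  moreover have "vec.dim (V (m - 1) (m - position V 1 m)) \<le> vec.dim (V m (m - position V 1 m))"
    by (intro dim_config_mono[OF V k]) auto
  moreover have "\<not> 2 \<le> vec.dim (V m (m - position V 1 m))"
    using dim_config_iff(2)[of m "m - position V 1 m"] assms(2) by simp
  ultimately have 2: "vec.dim (V m (m - position V 1 m)) = 1" by linarith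
  have "V (m - 1) (m - position V 1 m) = V m (m - position V 1 m)"
    using 1 2 by (intro config_eqI[OF V k]) auto
  then show ?thesis using config_dim_1[OF 2] line_vec(2)[OF assms(1)] by simp
qed

text \<open>At the height where flag \<open>m\<close> reaches dimension 2, the next flag is not yet
  full, so the two planes agree.\<close>

lemma plane_eq_next_plane:
  assumes "position V 3 (m + 1) \<le> position V 2 m"
  shows "vec.span {plane_form V m} = vec.span {plane_form V (m + 1)}"
proof -
  have "position V 3 m < position V 3 (m + 1)" using position_less[OF V k] by simp
  then have 1: "vec.dim (V (m - 1) (m - position V 2 m)) = 2"
    using dim_config_iff(2,3)[of "m - 1" "m - position V 2 m"] assms by simp
  moreover have "vec.dim (V (m - 1) (m - position V 2 m)) \<le> vec.dim (V m (m - position V 2 m))"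
    by (intro dim_config_mono[OF V k]) auto
  moreover have "\<not> 3 \<le> vec.dim (V m (m - position V 2 m))"
    using dim_config_iff(3)[of m "m - position V 2 m"] assms by simp
  ultimately have 2: "vec.dim (V m (m - position V 2 m)) = 2" by linarith
  have "V (m - 1) (m - position V 2 m) = V m (m - position V 2 m)"
    using 1 2 by (intro config_eqI[OF V k]) auto
  then have "{x. plane_form V m \<bullet>\<bullet> x = 0} = {x. plane_form V (m + 1) \<bullet>\<bullet> x = 0}"
    using config_dim_2[OF 1] config_dim_2[OF 2] by simp
  then have "plane_form V m \<in> vec.span {plane_form V (m + 1)}" "plane_form V (m + 1) \<in> vec.span {plane_form V m}"
    by (blast intro: in_span_if_kernel_subset)+
  then show ?thesis by (simp add: vec.span_eq)
qed

end

section \<open>Indecomposability forces interlacing\<close>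

context
  fixes n :: nat and V :: "int \<Rightarrow> int \<Rightarrow> (complex ^ 3) set" and M :: "('v::ab_group_add) rep"
  assumes CM: "CM 3 n 3 M" and indec: "indecomposable n M" and lat: "lattice_diagram 3 n M V" and n: "3 \<le> n"
begin

private lemma V: "config 3 n V"
  using lat by (simp add: lattice_diagram_def)

text \<open>By periodicity any three consecutive flags contain every space of the diagram, so a
  decomposition adapted to their existing members would decompose \<open>M\<close>.\<close>

lemma flags_not_split:
  assumes "splits A G"
    and A: "\<And>x. x \<in> {m, m + 1, m + 2} \<Longrightarrow> position V 2 x < position V 1 x \<Longrightarrow> \<exists>a\<in>A. line_vec V x \<in> vec.span {a}"
    and G: "\<And>x. x \<in> {m, m + 1, m + 2} \<Longrightarrow> position V 3 x < position V 2 x \<Longrightarrow> \<exists>g\<in>G. plane_form V x \<in> vec.span {g}"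
  shows False
proof -
  define A' where "A' = {line_vec V x | x. x \<in> {m, m + 1, m + 2} \<and> position V 2 x < position V 1 x}"
  define G' where "G' = {plane_form V x | x. x \<in> {m, m + 1, m + 2} \<and> position V 3 x < position V 2 x}"
  have "splits A' G'" using assms(1) by (rule splits_mono) (use A G in \<open>auto simp: A'_def G'_def\<close>)
  moreover have "\<not> splits A' G'"
  proof (rule indecomposable_not_splits[OF CM indec lat n])
    fix a b
    define s where "s = (a + 1 - m) div 3"
    have "a + 1 - 3 * s - m = (a + 1 - m) mod 3" unfolding s_def by presburger
    then have x: "a - 3 * s + 1 \<in> {m, m + 1, m + 2}" by force
    define z where "z = a - 3 * s + 1"
    have z: "z \<in> {m, m + 1, m + 2}" using x by (simp only: z_def)
    have "V a b = V (a - 3 * s) (b + (int n - 3) * s)"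
      using config_period[OF V, of "a - 3 * s" s b] by simp
    then have "V a b = {0} \<or> V a b = UNIV \<or>
       position V 2 z < position V 1 z \<and> V a b = vec.span {line_vec V z} \<or>
       position V 3 z < position V 2 z \<and> V a b = {x. plane_form V z \<bullet>\<bullet> x = 0}"
      using config_cases[OF V, of "a - 3 * s" "b + (int n - 3) * s"] by (simp only: z_def)
    moreover have "position V 2 z < position V 1 z \<Longrightarrow> line_vec V z \<in> A'"
      "position V 3 z < position V 2 z \<Longrightarrow> plane_form V z \<in> G'"
      using z unfolding A'_def G'_def by blast+
    ultimately show "V a b = {0} \<or> V a b = UNIV \<or> (\<exists>x\<in>A'. V a b = vec.span {x}) \<or> (\<exists>g\<in>G'. V a b = {x. g \<bullet>\<bullet> x = 0})"
      by blast
  qed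
  ultimately show False by blast
qed

text \<open>A failing inequality and the unique coincidence are combined into one of the splitting
  patterns. The coincidence is at index \<open>x\<close> of rim \<open>i\<close> and index
  \<open>y\<close> of rim \<open>j\<close>; the cases are the pairs of rims and whether
  \<open>x = y\<close>.\<close>

lemma positions_interlaced:
  assumes ij: "1 \<le> i" "i < j" "j \<le> 3" and tie: "position V i x = position V j y"
    and unique: "\<And>i' j' x' y'. \<lbrakk>1 \<le> i'; i' < j'; j' \<le> 3; position V i' x' = position V j' y'\<rbrakk> \<Longrightarrow>
      i' = i \<and> j' = j \<and> (\<exists>t. x' = x + 3 * t \<and> y' = y + 3 * t)"
  shows "position V 1 m \<le> position V 3 (m + 1)"
proof (rule ccontr)
  assume m: "\<not> ?thesis"
  note iff = position_less_iff[OF V]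
  note inc = line_in_plane[OF V] line_in_next_plane[OF V]
  have le: "position V 3 z \<le> position V 2 z" "position V 2 z \<le> position V 1 z" for z
    using position_antimono[OF V, of _ _ z] by simp_all
  \<comment> \<open>Periodicity moves the failure next to \<open>x\<close>, leaving three places for
    it.\<close>
  have w: "position V 3 x < position V 1 (x - 1) \<or> position V 3 (x + 1) < position V 1 x \<or>
      position V 3 (x + 2) < position V 1 (x + 1)"
  proof -
    define s where "s = (m - x + 1) div 3"
    have "m - 3 * s - x + 1 = (m - x + 1) mod 3" unfolding s_def by presburger
    then have "m - 3 * s \<in> {x - 1, x, x + 1}" by force
    moreover have "position V 3 (m - 3 * s + 1) < position V 1 (m - 3 * s)"
      using m position_period_mult[OF V, of 1 "m - 3 * s" s] position_period_mult[OF V, of 3 "m - 3 * s + 1" s]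
      by (simp add: algebra_simps)
    ultimately show ?thesis by (auto simp: add.commute)
  qed
  have xy: "x \<le> y"
    using iff[of j y x] position_antimono[OF V, of i j x] tie ij by force
  consider (13) "i = 1" "j = 3" | (12) "i = 1" "j = 2" | (23) "i = 2" "j = 3" using ij by linarith
  then show False
  proof cases
    case 13
    have L: "position V 2 z < position V 1 z" and P: "position V 3 z < position V 2 z" for z
      using unique[of 1 2 z z] unique[of 2 3 z z] le[of z] 13 by force+
    \<comment> \<open>All flags are complete here, so two consecutive inclusions already fit
      \<open>splits_chain\<close>.\<close>
    have chain: False if "position V 3 (z + 1) \<le> position V 1 z" "position V 3 (z + 2) \<le> position V 1 (z + 1)" for z
    proof (rule flags_not_split[where m = z])
      have "plane_form V (z + 1 + 1) \<bullet>\<bullet> line_vec V (z + 1) = 0"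
        by (rule inc(2)) (use L P that in \<open>simp_all add: add.assoc\<close>)
      then show "splits {line_vec V z, line_vec V (z + 1), line_vec V (z + 2)}
          {plane_form V z, plane_form V (z + 1), plane_form V (z + 2)}"
        using L P that by (intro splits_chain line_vec[OF V] plane_form[OF V] inc) (auto simp: add.assoc)
    qed auto
    have "x \<noteq> y" using tie 13 L[of x] P[of x] by auto
    then have xy: "x + 1 \<le> y" using xy by simp
    \<comment> \<open>The coincidence itself gives the inclusion at \<open>x\<close>. A failure at
      \<open>x - 1\<close> or \<open>x + 1\<close> adds an adjacent one; a failure at
      \<open>x\<close> pushes \<open>y\<close> further away, which gives the inclusion at
      \<open>x + 1\<close>.\<close>
    then have "position V 3 (x + 1) \<le> position V 1 x"
      using iff[of 3 y "x + 1"] tie 13 by simp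
    moreover have "position V 3 (x + 2) \<le> position V 1 (x + 1)" if "position V 3 (x + 1) < position V 1 x"
    proof -
      have "x + 1 < y" using that tie 13 iff[of 3 "x + 1" y] by simp
      then have "position V 3 (x + 2) \<le> position V 1 x" using iff[of 3 y "x + 2"] tie 13 by simp
      then show ?thesis using iff[of 1 x "x + 1"] by simp
    qed
    ultimately show False using w chain[of "x - 1"] chain[of x] by (auto simp: add.commute)
  next
    case 12
    have P: "position V 3 z < position V 2 z" for z
      using unique[of 2 3 z z] le[of z] 12 by force
    have L: "position V 2 z < position V 1 z" if "\<not> (\<exists>t. z = x + 3 * t \<and> z = y + 3 * t)" for z
      using unique[of 1 2 z z] le[of z] that 12 by force
    show False
    proof (cases "x = y")
      case True
      have "position V 2 x = position V 1 x" using tie 12 True by simp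
      then have no: "\<not> position V 2 x < position V 1 x" "position V 2 (x + 1) < position V 1 (x + 1)"
        "position V 2 (x + 2) < position V 1 (x + 2)" "position V 2 (x - 1) < position V 1 (x - 1)"
        using L[of "x + 1"] L[of "x + 2"] L[of "x - 1"] by (auto, presburger+)
      from w show False
      proof (elim disjE)
        \<comment> \<open>Flag \<open>x\<close> has no line. The line of flag \<open>x - 1\<close>
          lies in its own plane and in that of flag \<open>x\<close>.\<close>
        assume a: "position V 3 x < position V 1 (x - 1)"
        have "plane_form V (x - 1 + 1) \<bullet>\<bullet> line_vec V (x - 1) = 0"
          by (rule inc(2)) (use no P a in auto)
        then have "splits {line_vec V (x + 1), line_vec V (x - 1)} {plane_form V (x + 1), plane_form V (x - 1), plane_form V x}"
          using no P by (intro splits_flags line_vec[OF V] inc) auto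
        then show False
          by (rule flags_not_split[where m = "x - 1"]) (use no in \<open>auto simp: add.commute\<close>)
      next
        \<comment> \<open>Positions 1 and 2 agree at \<open>x\<close>, so the failure identifies two
          planes. Two flags remain, and the repeated form only fills the third slot of the
          pattern.\<close>
        assume a: "position V 3 (x + 1) < position V 1 x"
        then have eq: "vec.span {plane_form V x} = vec.span {plane_form V (x + 1)}"
          using tie 12 True by (intro plane_eq_next_plane[OF V]) auto
        have mem: "plane_form V x \<in> vec.span {plane_form V (x + 1)}" unfolding eq[symmetric] by simp
        have "splits {line_vec V (x + 2), line_vec V (x + 1)} {plane_form V (x + 2), plane_form V (x + 1), plane_form V (x + 1)}"
          using no P by (intro splits_flags line_vec[OF V] inc) auto
        then show False
          by (rule flags_not_split[where m = x]) (use no in \<open>auto simp: mem\<close>)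
      next
        \<comment> \<open>The inclusion joins the two flags that have a line; the plane of flag
          \<open>x\<close> is unconstrained.\<close>
        assume a: "position V 3 (x + 2) < position V 1 (x + 1)"
        have "plane_form V (x + 1 + 1) \<bullet>\<bullet> line_vec V (x + 1) = 0"
          by (rule inc(2)) (use no P a in \<open>auto simp: add.assoc\<close>)
        then have "splits {line_vec V (x + 1), line_vec V (x + 2)} {plane_form V (x + 1), plane_form V (x + 2), plane_form V x}"
          using no P by (intro splits_path line_vec[OF V] plane_form[OF V] inc) (auto simp: add.assoc)
        then show False
          by (rule flags_not_split[where m = x]) (use no in auto)
      qed
    next
      case False
      then have L: "position V 2 z < position V 1 z" for z using L by auto
      \<comment> \<open>Since \<open>x < y\<close>, the lines of flags \<open>x\<close> and
        \<open>x + 1\<close> coincide, and this common line lies in both planes.\<close>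
      have a: "position V 2 (x + 1) \<le> position V 1 x"
        using iff[of 2 y "x + 1"] tie 12 False xy by simp
      then have eq: "vec.span {line_vec V x} = vec.span {line_vec V (x + 1)}"
        using L by (intro line_eq_next_line[OF V]) auto
      have mem: "line_vec V (x + 1) \<in> vec.span {line_vec V x}" unfolding eq by simp
      have "position V 3 (x + 1) \<le> position V 1 x" using a le(1)[of "x + 1"] by simp
      then have "splits {line_vec V (x + 2), line_vec V x} {plane_form V (x + 2), plane_form V x, plane_form V (x + 1)}"
        using L P by (intro splits_flags line_vec[OF V] inc) auto
      then show False
        by (rule flags_not_split[where m = x]) (auto simp: mem)
    qed
  next
    case 23
    \<comment> \<open>This case is dual to the previous one; \<open>pc\<close> exchanges the
      arguments of the pairing so that the incidence lemmas apply with forms in the role of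
      vectors.\<close>
    note pc = trans[OF pairing_commute]
    have L: "position V 2 z < position V 1 z" for z
      using unique[of 1 2 z z] le[of z] 23 by force
    have P: "position V 3 z < position V 2 z" if "\<not> (\<exists>t. z = x + 3 * t \<and> z = y + 3 * t)" for z
      using unique[of 2 3 z z] le[of z] that 23 by force
    show False
    proof (cases "x = y")
      case True
      have "position V 3 x = position V 2 x" using tie 23 True by simp
      then have no: "\<not> position V 3 x < position V 2 x" "position V 3 (x + 1) < position V 2 (x + 1)"
        "position V 3 (x + 2) < position V 2 (x + 2)" "position V 3 (x - 1) < position V 2 (x - 1)"
        using P[of "x + 1"] P[of "x + 2"] P[of "x - 1"] by (auto, presburger+)
      from w show False
      proof (elim disjE)
        \<comment> \<open>Positions 2 and 3 agree at \<open>x\<close>, so the failure identifies two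
          lines.\<close>
        assume a: "position V 3 x < position V 1 (x - 1)"
        then have "vec.span {line_vec V (x - 1)} = vec.span {line_vec V (x - 1 + 1)}"
          using L tie 23 True by (intro line_eq_next_line[OF V]) auto
        then have mem: "line_vec V x \<in> vec.span {line_vec V (x - 1)}" by simp
        have "splits {line_vec V (x + 1), line_vec V (x - 1)} {plane_form V (x + 1), plane_form V (x - 1), plane_form V (x - 1)}"
          using no L by (intro splits_flags line_vec[OF V] inc) auto
        then show False
          by (rule flags_not_split[where m = "x - 1"]) (use no in \<open>auto simp: mem add.commute\<close>)
      next
        assume a: "position V 3 (x + 1) < position V 1 x"
        then have "splits {plane_form V (x + 2), plane_form V (x + 1)} {line_vec V (x + 2), line_vec V x, line_vec V (x + 1)}"
          using no L by (intro splits_flags plane_form[OF V] pc[OF inc(1)] pc[OF inc(2)]) auto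
        from splits_commute[OF this] show False
          by (rule flags_not_split[where m = x]) (use no in auto)
      next
        \<comment> \<open>Flag \<open>x\<close> has no plane, so its line is the unconstrained
          member of the dual path.\<close>
        assume a: "position V 3 (x + 2) < position V 1 (x + 1)"
        have "plane_form V (x + 1 + 1) \<bullet>\<bullet> line_vec V (x + 1) = 0"
          by (rule inc(2)) (use no L a in \<open>auto simp: add.assoc\<close>)
        then have "line_vec V (x + 1) \<bullet>\<bullet> plane_form V (x + 2) = 0"
          by (simp add: add.assoc pairing_commute[of "line_vec V (x + 1)"])
        then have "splits {plane_form V (x + 2), plane_form V (x + 1)} {line_vec V (x + 2), line_vec V (x + 1), line_vec V x}"
          using no L by (intro splits_path plane_form[OF V] line_vec[OF V] pc[OF inc(1)]) auto
        from splits_commute[OF this] show False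
          by (rule flags_not_split[where m = x]) (use no in auto)
      qed
    next
      case False
      then have P: "position V 3 z < position V 2 z" for z using P by auto
      have a: "position V 3 (x + 1) \<le> position V 2 x"
        using iff[of 3 y "x + 1"] tie 23 False xy by simp
      then have eq: "vec.span {plane_form V x} = vec.span {plane_form V (x + 1)}"
        by (intro plane_eq_next_plane[OF V]) auto
      have mem: "plane_form V x \<in> vec.span {plane_form V (x + 1)}" unfolding eq[symmetric] by simp
      have "position V 3 (x + 1) \<le> position V 1 x" using a le(2)[of x] by simp
      then have "splits {plane_form V (x + 2), plane_form V (x + 1)} {line_vec V (x + 2), line_vec V x, line_vec V (x + 1)}"
        using P L by (intro splits_flags plane_form[OF V] pc[OF inc(1)] pc[OF inc(2)]) auto
      from splits_commute[OF this] show False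
        by (rule flags_not_split[where m = x]) (auto simp: mem)
    qed
  qed
qed

end

section \<open>The quadratic form of $J_{k,n}$\<close>

context
  fixes k n :: nat
  assumes kn: "0 < k" "k < n"
begin

lemma root_vec_eq:
  "root_vec k n c j = (if 2 \<le> j \<and> j \<le> n then c (j - 1) else 0) - (if 1 \<le> j \<and> j < n then c j else 0)
     + (if 1 \<le> j \<and> j \<le> k then c n else 0)"
proof -
  have n: "n \<ge> 1" using kn by simp
  have "root_vec k n c j = (\<Sum>i\<in>{1..<n}. c i * simple_vec k n i j) + c n * simple_vec k n n j"
  proof -
    have "{1..n} = insert n {1..<n}" using n by auto
    then show ?thesis by (simp add: root_vec_def)
  qed
  also have "(\<Sum>i\<in>{1..<n}. c i * simple_vec k n i j) =
      (\<Sum>i\<in>{1..<n}. (if i = j - 1 then (if 2 \<le> j then c (j - 1) else 0) else 0) - (if i = j then c j else 0))"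
    by (rule sum.cong) (auto simp: simple_vec_def)
  also have "\<dots> = (if 2 \<le> j \<and> j \<le> n then c (j - 1) else 0) - (if 1 \<le> j \<and> j < n then c j else 0)"
    by (auto simp: sum_subtractf)
  finally show ?thesis by (auto simp: simple_vec_def)
qed

text \<open>The sum telescopes. It expresses the coefficients through partial sums of the vector,
  which yields both injectivity and the explicit inverse used for surjectivity.\<close>

lemma root_vec_partial_sum:
  assumes "j \<le> n"
  shows "(\<Sum>i=1..j. root_vec k n c i) = int (min j k) * c n - (if 1 \<le> j \<and> j < n then c j else 0)"
  using assms
proof (induction j)
  case (Suc j)
  then show ?case using kn
    by (auto simp: root_vec_eq min_def algebra_simps)
qed simp

lemma root_vec_sum: "(\<Sum>i=1..n. root_vec k n c i) = int k * c n"
  using root_vec_partial_sum[of n c] kn by simp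

lemma root_vec_inj: "inj_on (root_vec k n) {c. \<forall>i. i \<notin> {1..n} \<longrightarrow> c i = 0}"
proof (rule inj_onI, rule ext)
  fix c d i
  assume c: "c \<in> {c. \<forall>i. i \<notin> {1..n} \<longrightarrow> c i = 0}" and d: "d \<in> {c. \<forall>i. i \<notin> {1..n} \<longrightarrow> c i = 0}"
    and eq: "root_vec k n c = root_vec k n d"
  have n: "c n = d n" using root_vec_sum[of c] root_vec_sum[of d] eq kn by simp
  show "c i = d i"
  proof (cases "i \<in> {1..<n}")
    case True
    then show ?thesis using root_vec_partial_sum[of i c] root_vec_partial_sum[of i d] eq n by simp
  next
    case False
    then show ?thesis using c d n by (cases "i = n") auto
  qed
qed

lemma root_vec_surj:
  assumes x: "\<And>i. i \<notin> {1..n} \<Longrightarrow> x i = 0" and s: "(\<Sum>i=1..n. x i) = int k * s"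
  shows "x \<in> root_vec k n ` {c. \<forall>i. i \<notin> {1..n} \<longrightarrow> c i = 0}"
proof
  define c where "c i = (if i = n then s else if i \<in> {1..n} then int (min i k) * s - (\<Sum>l=1..i. x l) else 0)" for i
  show "c \<in> {c. \<forall>i. i \<notin> {1..n} \<longrightarrow> c i = 0}" using kn by (auto simp: c_def)
  show "x = root_vec k n c"
  proof
    fix j
    consider "j = 0 \<or> n < j" | "j = 1" | i where "j = Suc i" "1 \<le> i" "j < n" | i where "n = Suc i" "j = n" "1 \<le> i"
      using kn by (cases "j = 0 \<or> n < j"; cases "j = 1"; cases j; cases n) force+
    then show "x j = root_vec k n c j"
    proof cases
      case 1
      then show ?thesis using kn x[of j] by (auto simp: root_vec_eq)
    next
      case 2
      then show ?thesis using kn x[of 1] s by (auto simp: root_vec_eq c_def algebra_simps)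
    next
      case 3
      then show ?thesis by (auto simp: root_vec_eq c_def min_def algebra_simps)
    next
      case 4
      then show ?thesis unfolding root_vec_eq using kn s by (auto simp: c_def min_def algebra_simps)
    qed
  qed
qed

lemma root_vec_refl:
  assumes "i \<in> {1..n}"
  shows "root_vec k n (refl k n i c) j = root_vec k n c j - (\<Sum>l=1..n. cartan k n i l * c l) * simple_vec k n i j"
proof -
  have "root_vec k n (refl k n i c) j = (\<Sum>l=1..n. c l * simple_vec k n l j -
      (if l = i then (\<Sum>l=1..n. cartan k n i l * c l) * simple_vec k n i j else 0))"
    unfolding root_vec_def refl_def by (rule sum.cong) (auto simp: algebra_simps)
  then show ?thesis using assms by (simp add: sum_subtractf root_vec_def)
qed

text \<open>The reflection at a node \<open>i < n\<close> of the line exchanges coordinates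
  \<open>i\<close> and \<open>i + 1\<close>.\<close>

lemma cartan_sum_line:
  assumes "1 \<le> i" "i < n"
  shows "(\<Sum>l=1..n. cartan k n i l * c l) = root_vec k n c (Suc i) - root_vec k n c i"
proof -
  \<comment> \<open>Node \<open>n\<close> is attached to \<open>k\<close> and not to the end of the
    line, hence the guard \<open>Suc i < n\<close> and the separate last term.\<close>
  have "(\<Sum>l=1..n. cartan k n i l * c l) = (\<Sum>l=1..n. (if l = i then 2 * c i else 0)
      - (if l = Suc i then (if Suc i < n then c (Suc i) else 0) else 0)
      - (if l = i - 1 then (if 2 \<le> i then c (i - 1) else 0) else 0)
      - (if l = n then (if i = k then c n else 0) else 0))"
    using assms kn by (intro sum.cong refl) (auto simp: cartan_def J_adj_def)
  also have "\<dots> = 2 * c i - (if Suc i < n then c (Suc i) else 0) - (if 2 \<le> i then c (i - 1) else 0) - (if i = k then c n else 0)"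
    using assms by (auto simp: sum_subtractf)
  also have "\<dots> = root_vec k n c (Suc i) - root_vec k n c i"
    using assms kn by (auto simp: root_vec_eq)
  finally show ?thesis .
qed

lemma cartan_sum_branch:
  "(\<Sum>l=1..n. cartan k n n l * c l) = (\<Sum>l=1..k. root_vec k n c l) - (int k - 2) * c n"
proof -
  have "(\<Sum>l=1..n. cartan k n n l * c l) = (\<Sum>l=1..n. (if l = n then 2 * c n else 0) - (if l = k then c k else 0))"
    using kn by (intro sum.cong HOL.refl) (auto simp: cartan_def J_adj_def)
  also have "\<dots> = 2 * c n - c k" using kn by (auto simp: sum_subtractf)
  finally show ?thesis using root_vec_partial_sum[of k c] kn by (simp add: algebra_simps)
qed

text \<open>This is \<open>q = 2\<close>, because the coordinates sum to \<open>k * c n\<close>. It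
  holds for simple roots, and simple reflections preserve \<open>q\<close>.\<close>

lemma real_root_square_sum:
  assumes "c \<in> real_roots k n"
  shows "(\<Sum>j=1..n. (root_vec k n c j)\<^sup>2) = 2 + (int k - 2) * (c n)\<^sup>2"
  using assms(1)
proof induction
  case (simple i)
  have v: "root_vec k n (\<lambda>j. if j = i then 1 else 0) = simple_vec k n i"
  proof
    fix j
    have "root_vec k n (\<lambda>j. if j = i then 1 else 0) j = (\<Sum>l=1..n. if l = i then simple_vec k n i j else 0)"
      unfolding root_vec_def by (rule sum.cong) auto
    then show "root_vec k n (\<lambda>j. if j = i then 1 else 0) j = simple_vec k n i j" using simple by simp
  qed
  show ?case
  proof (cases "i < n")
    case True
    have "(\<Sum>j=1..n. (simple_vec k n i j)\<^sup>2) = (\<Sum>j=1..n. (if j = i then 1 else 0) + (if j = Suc i then 1 else 0))"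
      using True by (intro sum.cong) (auto simp: simple_vec_def)
    also have "\<dots> = 2" using True simple by (simp add: sum.distrib)
    finally show ?thesis using True v by simp
  next
    case False
    have "(\<Sum>j=1..n. (simple_vec k n i j)\<^sup>2) = (\<Sum>j=1..n. if j \<in> {1..k} then 1 else 0)"
      using False by (intro sum.cong) (auto simp: simple_vec_def)
    also have "\<dots> = (\<Sum>j\<in>{1..k}. 1)"
      by (rule sum.mono_neutral_cong_right) (use kn in auto)
    finally show ?thesis using False simple v by simp
  qed
next
  case (reflect c i)
  define s where "s = (\<Sum>l=1..n. cartan k n i l * c l)"
  have r: "root_vec k n (refl k n i c) j = root_vec k n c j - s * simple_vec k n i j" for j
    unfolding s_def by (rule root_vec_refl) (use reflect in auto)
  have "(\<Sum>j=1..n. (root_vec k n (refl k n i c) j)\<^sup>2) = (\<Sum>j=1..n. (root_vec k n c j)\<^sup>2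
      + (s\<^sup>2 * (simple_vec k n i j)\<^sup>2 - 2 * s * root_vec k n c j * simple_vec k n i j))"
    unfolding r by (intro sum.cong) (auto simp: power2_eq_square algebra_simps)
  also have "\<dots> = (\<Sum>j=1..n. (root_vec k n c j)\<^sup>2) +
      (\<Sum>j=1..n. s\<^sup>2 * (simple_vec k n i j)\<^sup>2 - 2 * s * root_vec k n c j * simple_vec k n i j)"
    by (simp add: sum.distrib)
  finally have *: "(\<Sum>j=1..n. (root_vec k n (refl k n i c) j)\<^sup>2) = 2 + (int k - 2) * (c n)\<^sup>2 +
      (\<Sum>j=1..n. s\<^sup>2 * (simple_vec k n i j)\<^sup>2 - 2 * s * root_vec k n c j * simple_vec k n i j)"
    using reflect.IH by simp
  show ?case
  proof (cases "i < n")
    case True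
    then have i: "i \<ge> 1" using reflect by simp
    have s: "s = root_vec k n c (Suc i) - root_vec k n c i"
      unfolding s_def by (rule cartan_sum_line) (use True i in auto)
    have "(\<Sum>j=1..n. s\<^sup>2 * (simple_vec k n i j)\<^sup>2 - 2 * s * root_vec k n c j * simple_vec k n i j) =
        (\<Sum>j=1..n. (if j = i then s\<^sup>2 + 2 * s * root_vec k n c i else 0) +
           (if j = Suc i then s\<^sup>2 - 2 * s * root_vec k n c (Suc i) else 0))"
      using True by (intro sum.cong) (auto simp: simple_vec_def)
    also have "\<dots> = s\<^sup>2 + 2 * s * root_vec k n c i + (s\<^sup>2 - 2 * s * root_vec k n c (Suc i))"
      using True i by (simp add: sum.distrib)
    also have "\<dots> = 0" unfolding s by (simp add: power2_eq_square algebra_simps)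
    finally have 0: "(\<Sum>j=1..n. s\<^sup>2 * (simple_vec k n i j)\<^sup>2 - 2 * s * root_vec k n c j * simple_vec k n i j) = 0" .
    have "refl k n i c n = c n" using True by (simp add: refl_def)
    then show ?thesis using * unfolding 0 by simp
  next
    case False
    then have i: "i = n" using reflect by simp
    have s: "(\<Sum>l=1..k. root_vec k n c l) = s + (int k - 2) * c n"
      using cartan_sum_branch[of c] by (simp add: s_def i)
    have "(\<Sum>j=1..n. s\<^sup>2 * (simple_vec k n i j)\<^sup>2 - 2 * s * root_vec k n c j * simple_vec k n i j) =
        (\<Sum>j\<in>{1..k}. s\<^sup>2 - 2 * s * root_vec k n c j)"
      by (rule sum.mono_neutral_cong_right) (use kn in \<open>auto simp: simple_vec_def i\<close>)
    also have "\<dots> = int k * s\<^sup>2 - 2 * s * (\<Sum>l=1..k. root_vec k n c l)"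
      by (simp add: sum_subtractf sum_distrib_left)
    also have "\<dots> = (int k - 2) * (s\<^sup>2 - 2 * s * c n)"
      unfolding s by (simp add: power2_eq_square algebra_simps)
    finally have 0: "(\<Sum>j=1..n. s\<^sup>2 * (simple_vec k n i j)\<^sup>2 - 2 * s * root_vec k n c j * simple_vec k n i j) =
        (int k - 2) * (s\<^sup>2 - 2 * s * c n)" .
    have r: "refl k n i c n = c n - s" by (simp add: refl_def s_def i)
    show ?thesis using * unfolding 0 r by (simp add: power2_eq_square algebra_simps)
  qed
qed

end

section \<open>Canonical profiles\<close>

lemma profile_vec_eq_sum: "profile_vec P i = (\<Sum>j<length P. of_bool (i \<in> P ! j))"
  by (simp add: profile_vec_def of_bool_def sum.If_cases lessThan_def Collect_conj_eq)

text \<open>The coordinates \<open>x i\<close> count rows, with sum 9 and square sum 11. Hence the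
  nonnegative terms \<open>x i * (x i - 1)\<close> add up to 2, which leaves room for a single 2 and
  nothing larger.\<close>

lemma real_root_profile:
  assumes n: "4 \<le> n" and len: "length P = 3"
    and P: "\<And>j. j < 3 \<Longrightarrow> P ! j \<subseteq> {1..n} \<and> card (P ! j) = 3"
    and root: "phi 3 n P \<in> real_roots 3 n"
  obtains T where "T \<in> {1..n}" "profile_vec P T = 2" "\<And>i. i \<in> {1..n} \<Longrightarrow> i \<noteq> T \<Longrightarrow> profile_vec P i \<le> 1"
proof -
  have n3: "0 < (3::nat)" "3 < n" using n by simp_all
  define x where "x = profile_vec P"
  have "(\<Sum>i=1..n. x i) = (\<Sum>j<3. \<Sum>i=1..n. of_bool (i \<in> P ! j))"
    unfolding x_def profile_vec_eq_sum len by (rule sum.swap)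
  also have "\<dots> = (\<Sum>j<3::nat. (3::int))"
  proof (rule sum.cong)
    fix j :: nat assume "j \<in> {..<3}"
    then have "{1..n} \<inter> {i. i \<in> P ! j} = P ! j" "card (P ! j) = 3" using P[of j] by auto
    then show "(\<Sum>i=1..n. of_bool (i \<in> P ! j)) = (3::int)" by (simp add: sum.If_cases of_bool_def)
  qed simp
  finally have sum: "(\<Sum>i=1..n. x i) = 9" by simp
  have x0: "x i = 0" if "i \<notin> {1..n}" for i
  proof -
    have "i \<notin> P ! j" if "j < 3" for j using P[OF that] \<open>i \<notin> {1..n}\<close> by blast
    then have "{j. j < length P \<and> i \<in> P ! j} = {}" using len by simp
    then show ?thesis unfolding x_def profile_vec_def by simp
  qed
  have "x \<in> root_vec 3 n ` {c. \<forall>i. i \<notin> {1..n} \<longrightarrow> c i = 0}"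
    by (rule root_vec_surj[OF n3, where s = 3]) (use x0 sum in auto)
  then have rv: "root_vec 3 n (phi 3 n P) = x"
    unfolding phi_def x_def by (rule f_the_inv_into_f[OF root_vec_inj[OF n3]])
  have "phi 3 n P n = 3" using root_vec_sum[OF n3, of "phi 3 n P"] sum by (simp add: rv)
  then have sq: "(\<Sum>i=1..n. (x i)\<^sup>2) = 11"
    using real_root_square_sum[OF n3 root] by (simp add: rv)
  have x3: "0 \<le> x i" "x i \<le> 3" for i
  proof -
    have "card {j. j < length P \<and> i \<in> P ! j} \<le> card {..<length P}" by (rule card_mono) auto
    then show "0 \<le> x i" "x i \<le> 3" unfolding x_def profile_vec_def len by simp_all
  qed
  have g: "(\<Sum>i=1..n. x i * (x i - 1)) = 2"
    using sum sq by (simp add: algebra_simps power2_eq_square sum_subtractf)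
  have g0: "0 \<le> x i * (x i - 1)" for i using x3(1)[of i] by (cases "x i = 0") auto
  have "\<exists>T\<in>{1..n}. x T \<ge> 2"
  proof (rule ccontr)
    assume "\<not> ?thesis"
    then have "x i * (x i - 1) = 0" if "i \<in> {1..n}" for i using that x3(1)[of i] by force
    then have "(\<Sum>i=1..n. x i * (x i - 1)) = 0" by (intro sum.neutral) blast
    then show False using g by simp
  qed
  then obtain T where T: "T \<in> {1..n}" "x T \<ge> 2" by blast
  have *: "x T * (x T - 1) + (\<Sum>i\<in>{1..n} - {T}. x i * (x i - 1)) = 2"
    using g T(1) by (simp add: sum.remove[of _ T])
  have nonneg: "0 \<le> (\<Sum>i\<in>{1..n} - {T}. x i * (x i - 1))" by (intro sum_nonneg g0)
  have "x T = 2 \<or> x T = 3" using T(2) x3[of T] by linarith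
  then have T2: "x T = 2" using * nonneg by auto
  then have "(\<Sum>i\<in>{1..n} - {T}. x i * (x i - 1)) = 0" using * by simp
  then have "\<forall>i\<in>{1..n} - {T}. x i * (x i - 1) = 0"
    by (subst (asm) sum_nonneg_eq_0_iff) (use g0 in auto)
  then have "x i \<le> 1" if "i \<in> {1..n}" "i \<noteq> T" for i using that by force
  then show thesis using that T T2 by (auto simp: x_def)
qed

lemma canonical_rotate_iff:
  assumes len: "length P = 3"
  shows "canonical 3 (rotate r P) \<longleftrightarrow>
    (\<forall>j<3. entry P ((1 + r) mod 3) j \<le> entry P (r mod 3) j \<and> entry P ((2 + r) mod 3) j \<le> entry P ((1 + r) mod 3) j) \<and>
    (\<forall>j<2. entry P (r mod 3) j \<le> entry P ((2 + r) mod 3) (Suc j))"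
proof -
  have e: "entry (rotate r P) i j = entry P ((i + r) mod 3) j" if "i < 3" for i j
    using that len by (simp add: entry_def nth_rotate add.commute)
  have 1: "weakly_column_decreasing 3 (rotate r P) \<longleftrightarrow>
    (\<forall>j<3. entry P ((1 + r) mod 3) j \<le> entry P (r mod 3) j \<and> entry P ((2 + r) mod 3) j \<le> entry P ((1 + r) mod 3) j)"
  proof -
    have "weakly_column_decreasing 3 (rotate r P) \<longleftrightarrow>
      (\<forall>j<3. \<forall>i<2. entry P ((i + r) mod 3) j \<ge> entry P ((Suc i + r) mod 3) j)"
      unfolding weakly_column_decreasing_def length_rotate len using e by fastforce
    then show ?thesis by (auto simp: numeral_2_eq_2 All_less_Suc)
  qed
  have "(\<forall>j. 1 \<le> j \<and> j < 3 \<longrightarrow> entry P ((2 + r) mod 3) j \<ge> entry P (r mod 3) (j - 1)) \<longleftrightarrow>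
    (\<forall>j<2. entry P (r mod 3) j \<le> entry P ((2 + r) mod 3) (Suc j))"
  proof safe
    fix j :: nat
    assume *: "\<forall>j<2. entry P (r mod 3) j \<le> entry P ((2 + r) mod 3) (Suc j)" and j: "1 \<le> j" "j < 3"
    show "entry P (r mod 3) (j - 1) \<le> entry P ((2 + r) mod 3) j"
      using *[rule_format, of "j - 1"] j by simp
  next
    fix j :: nat
    assume *: "\<forall>j. 1 \<le> j \<and> j < 3 \<longrightarrow> entry P (r mod 3) (j - 1) \<le> entry P ((2 + r) mod 3) j" and j: "j < 2"
    show "entry P (r mod 3) j \<le> entry P ((2 + r) mod 3) (Suc j)"
      using *[rule_format, of "Suc j"] j by simp
  qed
  then show ?thesis unfolding canonical_def 1 using e[of 2] e[of 0] len by simp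
qed

text \<open>The index \<open>t\<close> is the first with a positive position. Three steps add
  \<open>n\<close> to a position, so exactly the indices \<open>t\<close>, \<open>t + 1\<close>,
  \<open>t + 2\<close> land in \<open>{1..n}\<close>, in increasing order.\<close>

lemma entry_position:
  fixes V :: "int \<Rightarrow> int \<Rightarrow> (complex ^ 3) set"
  assumes V: "config 3 n V" and j: "j < 3" and P: "P ! j = rim_set n V (Suc j)"
    and t: "\<And>s. 0 < position V (Suc j) s \<longleftrightarrow> t \<le> s" and c: "c < 3"
  shows "entry P j c = nat (position V (Suc j) (t + int c))"
proof -
  let ?E = "position V (Suc j)"
  have k: "(3::nat) > 0" and j': "1 \<le> Suc j" "Suc j \<le> CARD(3)" using j by simp_all
  have pos: "0 < ?E t" "0 < ?E (t + 1)" "0 < ?E (t + 2)" using t by simp_all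
  have inc: "?E t < ?E (t + 1)" "?E (t + 1) < ?E (t + 2)" using position_less_iff[OF V k j'] by simp_all
  have "i \<in> P ! j \<longleftrightarrow> i \<in> {nat (?E t), nat (?E (t + 1)), nat (?E (t + 2))}" for i
  proof
    assume "i \<in> P ! j"
    then obtain s where s: "1 \<le> i" "i \<le> n" "int i = ?E s"
      unfolding P rim_set_position[OF V k j'] by auto
    have "t \<le> s" using t[of s] s by simp
    moreover have "\<not> t \<le> s - 3"
      using t[of "s - 3"] position_period[OF V k j', of "s - 3"] s by simp
    ultimately have "s \<in> {t, t + 1, t + 2}" by force
    moreover have "i = nat (?E s)" using s(3) by simp
    ultimately show "i \<in> {nat (?E t), nat (?E (t + 1)), nat (?E (t + 2))}" by blast
  next
    assume "i \<in> {nat (?E t), nat (?E (t + 1)), nat (?E (t + 2))}"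
    then obtain s where s: "s \<in> {t, t + 1, t + 2}" "i = nat (?E s)" by blast
    have "0 < ?E s" using t[of s] s(1) by auto
    moreover have "\<not> 0 < ?E (s - 3)" using t[of "s - 3"] s(1) by auto
    ultimately have "int i = ?E s" "1 \<le> i" "i \<le> n"
      using position_period[OF V k j', of "s - 3"] s(2) by simp_all
    then show "i \<in> P ! j"
      unfolding P rim_set_position[OF V k j'] by simp
  qed
  then have set: "P ! j = set [nat (?E t), nat (?E (t + 1)), nat (?E (t + 2))]" by auto
  have "sorted_list_of_set (P ! j) = [nat (?E t), nat (?E (t + 1)), nat (?E (t + 2))]"
    unfolding set by (rule sorted_list_of_set.idem_if_sorted_distinct) (use pos inc in auto)
  then show ?thesis using c by (auto simp: entry_def numeral_3_eq_3 less_Suc_eq)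
qed

text \<open>The positions form one weakly increasing chain that runs cyclically through rims 3, 2,
  1. Which rim is the first to enter the positive integers decides the rotation.\<close>

lemma canonical_if_positions_interlaced:
  fixes V :: "int \<Rightarrow> int \<Rightarrow> (complex ^ 3) set"
  assumes V: "config 3 n V" and len: "length P = 3" and P: "\<And>j. j < 3 \<Longrightarrow> P ! j = rim_set n V (Suc j)"
    and inter: "\<And>m. position V 1 m \<le> position V 3 (m + 1)"
  shows "\<exists>r. canonical 3 (rotate r P)"
proof -
  let ?E = "position V"
  have k: "(3::nat) > 0" by simp
  have le: "?E 3 m \<le> ?E 2 m" "?E 2 m \<le> ?E 1 m" for m
    using position_antimono[OF V k] by simp_all
  obtain t1 where t1: "\<And>s. 0 < ?E 1 s \<longleftrightarrow> t1 \<le> s" using position_threshold[OF V k, of 1] by auto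
  obtain t2 where t2: "\<And>s. 0 < ?E 2 s \<longleftrightarrow> t2 \<le> s" using position_threshold[OF V k, of 2] by auto
  obtain t3 where t3: "\<And>s. 0 < ?E 3 s \<longleftrightarrow> t3 \<le> s" using position_threshold[OF V k, of 3] by auto
  \<comment> \<open>Interlacing bounds the spread of the starting indices by one. Rows starting at
    \<open>t1 + 1\<close> must move above those starting at \<open>t1\<close>, which gives rotations
    0, 2 and 1 in the three cases.\<close>
  have t: "t1 \<le> t2" "t2 \<le> t3" "t3 \<le> t1 + 1"
    using t1[of t2] t2[of t2] le(2)[of t2] t2[of t3] t3[of t3] le(1)[of t3] t1[of t1] t3[of "t1 + 1"] inter[of t1]
    by linarith+
  have e: "entry P 0 c = nat (?E 1 (t1 + int c))" "entry P 1 c = nat (?E 2 (t2 + int c))"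
    "entry P 2 c = nat (?E 3 (t3 + int c))" if "c < 3" for c
    using entry_position[OF V _ P, of 0 t1 c] entry_position[OF V _ P, of 1 t2 c] entry_position[OF V _ P, of 2 t3 c]
      t1 t2 t3 that by (simp_all add: numeral_3_eq_3 numeral_2_eq_2)
  then have e': "entry P (Suc 0) c = nat (?E 2 (t2 + int c))" "entry P (Suc (Suc 0)) c = nat (?E 3 (t3 + int c))"
    if "c < 3" for c
    using that by (simp_all add: numeral_2_eq_2)
  have n: "nat (?E 3 s) \<le> nat (?E 2 s)" "nat (?E 2 s) \<le> nat (?E 1 s)" "nat (?E 1 s) \<le> nat (?E 3 (s + 1))"
    "nat (?E 3 (1 + s)) \<le> nat (?E 2 (1 + s))" "nat (?E 2 (1 + s)) \<le> nat (?E 1 (1 + s))" for s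
    using le inter by (simp_all only: nat_mono)
  from t consider "t2 = t1" "t3 = t1" | "t2 = t1" "t3 = t1 + 1" | "t2 = t1 + 1" "t3 = t1 + 1" by linarith
  then show ?thesis
  proof cases
    case 1
    have "canonical 3 (rotate 0 P)"
      unfolding canonical_rotate_iff[OF len]
    proof (intro conjI allI impI)
      fix j :: nat
      note n = n[of "t1 + int j"]
      assume "j < 3"
      then show "entry P ((1 + 0) mod 3) j \<le> entry P (0 mod 3) j" "entry P ((2 + 0) mod 3) j \<le> entry P ((1 + 0) mod 3) j"
        using n by (simp_all add: e e' 1 add_ac)
    next
      fix j :: nat
      note n = n[of "t1 + int j"]
      assume "j < 2"
      then show "entry P (0 mod 3) j \<le> entry P ((2 + 0) mod 3) (Suc j)"
        using n by (simp add: e e' 1 add_ac)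
    qed
    then show ?thesis ..
  next
    case 2
    have "canonical 3 (rotate 2 P)"
      unfolding canonical_rotate_iff[OF len]
    proof (intro conjI allI impI)
      fix j :: nat
      note n = n[of "t1 + int j"]
      assume "j < 3"
      then show "entry P ((1 + 2) mod 3) j \<le> entry P (2 mod 3) j" "entry P ((2 + 2) mod 3) j \<le> entry P ((1 + 2) mod 3) j"
        using n by (simp_all add: e e' 2 add_ac)
    next
      fix j :: nat
      note n = n[of "t1 + int j"]
      assume "j < 2"
      then show "entry P (2 mod 3) j \<le> entry P ((2 + 2) mod 3) (Suc j)"
        using n by (simp add: e e' 2 add_ac)
    qed
    then show ?thesis ..
  next
    case 3
    have "canonical 3 (rotate 1 P)"
      unfolding canonical_rotate_iff[OF len]
    proof (intro conjI allI impI)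
      fix j :: nat
      note n = n[of "t1 + int j"]
      assume "j < 3"
      then show "entry P ((1 + 1) mod 3) j \<le> entry P (1 mod 3) j" "entry P ((2 + 1) mod 3) j \<le> entry P ((1 + 1) mod 3) j"
        using n by (simp_all add: e e' 3 add_ac)
    next
      fix j :: nat
      note n = n[of "t1 + int j"]
      assume "j < 2"
      then show "entry P (1 mod 3) j \<le> entry P ((2 + 1) mod 3) (Suc j)"
        using n by (simp add: e e' 3 add_ac)
    qed
    then show ?thesis ..
  qed
qed

theorem theorem2:
  fixes n :: nat
    and M :: "('v::ab_group_add) rep"
    and V :: "int \<Rightarrow> int \<Rightarrow> (complex ^ 3) set"
    and P :: "nat set list"
  assumes "n \<ge> 6"
    and "CM 3 n 3 M"
    and "indecomposable n M"
    and "is_profile 3 n M V P"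
    and "phi 3 n P \<in> real_roots 3 n"
  shows "\<exists>r. canonical 3 (rotate r P)"
proof -
  let ?E = "position V"
  have filt: "filtration 3 n M P" and lat: "lattice_diagram 3 n M V" and len: "length P = 3"
    and P: "\<And>j. j < 3 \<Longrightarrow> P ! j = rim_set n V (Suc j)"
    using assms(4) unfolding is_profile_def by simp_all
  have V: "config 3 n V" using lat by (simp add: lattice_diagram_def)
  have k: "(3::nat) > 0" by simp
  have Pj: "P ! j \<subseteq> {1..n} \<and> card (P ! j) = 3" if "j < 3" for j
    using filt that len unfolding filtration_def by (metis nth_mem)
  obtain T where T: "T \<in> {1..n}" "profile_vec P T = 2" "\<And>i. i \<in> {1..n} \<Longrightarrow> i \<noteq> T \<Longrightarrow> profile_vec P i \<le> 1"
    using real_root_profile[OF _ len Pj assms(5)] assms(1) by auto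
  define R where "R i j \<longleftrightarrow> int i \<in> range (?E j)" for i j
  have count: "profile_vec P i = of_bool (R i 1) + of_bool (R i 2) + of_bool (R i 3)" if "i \<in> {1..n}" for i
  proof -
    have "i \<in> P ! j \<longleftrightarrow> R i (Suc j)" if "j < 3" for j
      using P[OF that] rim_set_position[OF V k, of "Suc j"] that \<open>i \<in> {1..n}\<close> by (auto simp: R_def)
    then show ?thesis
      by (simp add: profile_vec_eq_sum len numeral_3_eq_3 numeral_2_eq_2)
  qed
  have 123: "j \<in> {1, 2, 3}" if "1 \<le> j" "j \<le> 3" for j :: nat using that by auto
  consider "R T 1" "R T 2" | "R T 1" "R T 3" | "R T 2" "R T 3"
    using count[OF T(1)] T(2) by (auto simp: of_bool_def split: if_splits)
  then have "\<exists>i j. 1 \<le> i \<and> i < j \<and> j \<le> 3 \<and> R T i \<and> R T j"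
  proof cases
    case 1
    then show ?thesis by (intro exI[of _ 1] exI[of _ 2]) simp
  next
    case 2
    then show ?thesis by (intro exI[of _ 1] exI[of _ 3]) simp
  next
    case 3
    then show ?thesis by (intro exI[of _ 2] exI[of _ 3]) simp
  qed
  then obtain i j x y where ij: "1 \<le> i" "i < j" "j \<le> 3" and xy: "int T = ?E i x" "int T = ?E j y"
    unfolding R_def by blast
  have "?E 1 m \<le> ?E 3 (m + 1)" for m
  proof (rule positions_interlaced[OF assms(2,3) lat _ ij])
    show "?E i x = ?E j y" using xy by simp
    fix i' j' x' y' assume ij': "1 \<le> i'" "i' < j'" "j' \<le> 3" and eq: "?E i' x' = ?E j' y'"
    \<comment> \<open>Subtracting 1 before dividing selects the representative in
      \<open>{1..n}\<close> rather than \<open>{0..<n}\<close>.\<close>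
    define s where "s = (?E i' x' - 1) div int n"
    define z where "z = nat (?E i' x' - int n * s)"
    have "?E i' x' - int n * s = (?E i' x' - 1) mod int n + 1"
      unfolding s_def by (simp add: minus_mult_div_eq_mod[symmetric] algebra_simps)
    then have z1: "1 \<le> ?E i' x' - int n * s" "?E i' x' - int n * s \<le> int n"
      using assms(1) pos_mod_bound[of "int n" "?E i' x' - 1"] pos_mod_sign[of "int n" "?E i' x' - 1"] by linarith+
    then have z: "z \<in> {1..n}" "int z = ?E i' (x' - 3 * s)" "int z = ?E j' (y' - 3 * s)"
      using position_period_mult[OF V k, of i' "x' - 3 * s" s] position_period_mult[OF V k, of j' "y' - 3 * s" s] ij' eq
      by (auto simp: z_def)
    then have R: "R z i'" "R z j'" unfolding R_def by blast+
    then have "profile_vec P z \<ge> 2"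
      using count[OF z(1)] ij' 123[of i'] 123[of j'] by auto
    then have zT: "z = T" using T(3)[OF z(1)] by force
    have RT: "R T i" "R T j" using xy unfolding R_def by blast+
    \<comment> \<open>The element \<open>T\<close> lies in exactly two rows, so any coincidence over
      it involves the same pair of rims; injectivity of the positions then fixes the indices up to
      the period.\<close>
    have same: "i' = i \<and> j' = j"
      using R RT ij ij' 123[of i] 123[of j] 123[of i'] 123[of j'] count[OF T(1)] T(2) zT by auto
    then have "?E i (x' - 3 * s) = ?E i x" "?E j (y' - 3 * s) = ?E j y" using z xy zT by auto
    then have "x' - 3 * s = x" "y' - 3 * s = y"
      using position_eq_iff[OF V k] ij by simp_all
    then show "i' = i \<and> j' = j \<and> (\<exists>t. x' = x + 3 * t \<and> y' = y + 3 * t)"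
      using same by (auto intro!: exI[of _ s])
  qed (use assms(1) in simp)
  then show ?thesis by (intro canonical_if_positions_interlaced[OF V len] P)
qed

end
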